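(* Let $L$ be an even positive-definite lattice and $G=L^*/L$ with its pairing $\langle\cdot,\cdot\rangle$ as below. There is a one-to-one correspondence between the subgroups $Z\le G\times G$ satisfying $Z^\perp=Z$ (with respect to the pairing $\langle(g,h),(g',h')\rangle_2=\langle g,g'\rangle\overline{\langle h,h'\rangle}$) and the triples $(J,[\psi],\phi)$ where $J\le G$ is a subgroup containing no quaternionic elements, $\phi\in\widehat{J/2J}$ and $[\psi]\in H^2(J;\mathbb{T})$.
   Context: $L$ is a free $\mathbb{Z}$-module of finite rank with positive-definite symmetric bilinear form $u\cdot v$ and $u\cdot u\in2\mathbb{Z}$ for all $u\in L$; $L^*=\{v\in\mathbb{R}\otimes L:v\cdot L\subseteq\mathbb{Z}\}$. On $G=L^*/L$, $\langle[u],[v]\rangle=e^{-2\pi i u\cdot v}$. For a subgroup $Z$, $Z^\perp=\{k:\langle k,z\rangle_2=1\ \forall z\in Z\}$. An element $j\in G$ is quaternionic if the multiplicative order of $\langle j,j\rangle$ equals the order of $j$ in $G$ and this order is even. $\widehat{J/2J}$ denotes the character group of $J/2J$; $H^2(J;\mathbb{T})$ is group cohomology with trivial coefficients. *)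

theory Defs
  imports "HOL-Analysis.Analysis"
begin

text \<open>The lattice L, realised inside R (x) L = real^'n (Euclidean, since the form is
  positive definite) as the integer span of a basis b.\<close>
definition lat :: "('n::finite \<Rightarrow> real^'n) \<Rightarrow> (real^'n) set" where
  "lat b = range (\<lambda>k::'n \<Rightarrow> int. \<Sum>i\<in>UNIV. of_int (k i) *\<^sub>R b i)"

definition dual :: "(real^'n) set \<Rightarrow> (real^'n) set" where
  "dual L = {v. \<forall>u\<in>L. v \<bullet> u \<in> \<int>}"

definition coset :: "(real^'n) set \<Rightarrow> real^'n \<Rightarrow> (real^'n) set" where
  "coset L v = (\<lambda>l. v + l) ` L"

definition disc :: "(real^'n) set \<Rightarrow> (real^'n) set set" where
  "disc L = coset L ` dual L"

definition gadd :: "(real^'n) set \<Rightarrow> (real^'n) set \<Rightarrow> (real^'n) set" where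
  "gadd X Y = {x + y | x y. x \<in> X \<and> y \<in> Y}"

definition gneg :: "(real^'n) set \<Rightarrow> (real^'n) set" where
  "gneg X = uminus ` X"

definition rep :: "(real^'n) set \<Rightarrow> real^'n" where
  "rep X = (SOME v. v \<in> X)"

definition pair :: "(real^'n) set \<Rightarrow> (real^'n) set \<Rightarrow> complex" where
  "pair X Y = exp (- 2 * of_real pi * \<i> * of_real (rep X \<bullet> rep Y))"

definition pair2 :: "(real^'n) set \<times> (real^'n) set \<Rightarrow> (real^'n) set \<times> (real^'n) set \<Rightarrow> complex" where
  "pair2 k z = pair (fst k) (fst z) * cnj (pair (snd k) (snd z))"

definition subgrp :: "(real^'n) set \<Rightarrow> (real^'n) set set \<Rightarrow> bool" where
  "subgrp L J \<longleftrightarrow> J \<subseteq> disc L \<and> L \<in> J \<and> (\<forall>x\<in>J. \<forall>y\<in>J. gadd x y \<in> J) \<and> (\<forall>x\<in>J. gneg x \<in> J)"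

definition subgrp2 :: "(real^'n) set \<Rightarrow> ((real^'n) set \<times> (real^'n) set) set \<Rightarrow> bool" where
  "subgrp2 L Z \<longleftrightarrow> Z \<subseteq> disc L \<times> disc L \<and> (L, L) \<in> Z
     \<and> (\<forall>x\<in>Z. \<forall>y\<in>Z. (gadd (fst x) (fst y), gadd (snd x) (snd y)) \<in> Z)
     \<and> (\<forall>x\<in>Z. (gneg (fst x), gneg (snd x)) \<in> Z)"

definition perp :: "(real^'n) set \<Rightarrow> ((real^'n) set \<times> (real^'n) set) set \<Rightarrow> ((real^'n) set \<times> (real^'n) set) set" where
  "perp L Z = {k \<in> disc L \<times> disc L. \<forall>z\<in>Z. pair2 k z = 1}"

definition gord :: "(real^'n) set \<Rightarrow> (real^'n) set \<Rightarrow> nat" where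
  "gord L X = (LEAST n::nat. n > 0 \<and> real n *\<^sub>R rep X \<in> L)"

definition cord :: "complex \<Rightarrow> nat" where
  "cord z = (if \<exists>n::nat. n > 0 \<and> z ^ n = 1 then LEAST n::nat. n > 0 \<and> z ^ n = 1 else 0)"

definition quaternionic :: "(real^'n) set \<Rightarrow> (real^'n) set \<Rightarrow> bool" where
  "quaternionic L j \<longleftrightarrow> cord (pair j j) = gord L j \<and> even (gord L j)"

definition circle :: "complex set" where
  "circle = {z. cmod z = 1}"

text \<open>Characters of J/2J, identified with T-valued characters of J trivial on 2J
  (extended by 1 outside J).\<close>
definition chars2 :: "(real^'n) set set \<Rightarrow> ((real^'n) set \<Rightarrow> complex) set" where
  "chars2 J = {\<phi>. (\<forall>j\<in>J. \<phi> j \<in> circle)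
      \<and> (\<forall>x\<in>J. \<forall>y\<in>J. \<phi> (gadd x y) = \<phi> x * \<phi> y)
      \<and> (\<forall>j\<in>J. \<phi> (gadd j j) = 1)
      \<and> (\<forall>X. X \<notin> J \<longrightarrow> \<phi> X = 1)}"

definition cocycles :: "(real^'n) set set \<Rightarrow> ((real^'n) set \<Rightarrow> (real^'n) set \<Rightarrow> complex) set" where
  "cocycles J = {\<psi>. (\<forall>a\<in>J. \<forall>b\<in>J. \<psi> a b \<in> circle)
      \<and> (\<forall>a\<in>J. \<forall>b\<in>J. \<forall>c\<in>J. \<psi> b c * \<psi> a (gadd b c) = \<psi> (gadd a b) c * \<psi> a b)
      \<and> (\<forall>a b. a \<notin> J \<or> b \<notin> J \<longrightarrow> \<psi> a b = 1)}"

definition cohom :: "(real^'n) set set \<Rightarrow> ((real^'n) set \<Rightarrow> (real^'n) set \<Rightarrow> complex)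
    \<Rightarrow> ((real^'n) set \<Rightarrow> (real^'n) set \<Rightarrow> complex) \<Rightarrow> bool" where
  "cohom J \<psi> \<psi>' \<longleftrightarrow> (\<exists>f. (\<forall>a\<in>J. f a \<in> circle)
      \<and> (\<forall>a\<in>J. \<forall>b\<in>J. \<psi>' a b = \<psi> a b * f a * f b / f (gadd a b)))"

definition H2 :: "(real^'n) set set \<Rightarrow> ((real^'n) set \<Rightarrow> (real^'n) set \<Rightarrow> complex) set set" where
  "H2 J = {{\<psi>' \<in> cocycles J. cohom J \<psi> \<psi>'} | \<psi>. \<psi> \<in> cocycles J}"

end

theory Submission
  imports Defs "HOL-Algebra.Multiplicative_Group"
begin

text \<open>Let \<open>B\<close> be the pairing on \<open>G = L\<^sup>*/L\<close>. A subgroup \<open>Z = Z\<^sup>\<bottom>\<close> is determined by the group \<open>J\<close> of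
  differences \<open>g - h\<close> for \<open>(g, h)\<close> in \<open>Z\<close> together with the bicharacter \<open>\<beta>\<close> on \<open>J\<close> given by
  \<open>\<beta> (g - h) k = B g k\<close>; the condition \<open>Z = Z\<^sup>\<bottom>\<close> becomes \<open>\<beta> x y * \<beta> y x = B x y\<close>.
  Such a \<open>\<beta>\<close> exists if and only if \<open>J\<close> has no quaternionic element. Two choices differ by a
  bicharacter \<open>\<delta>\<close> with \<open>\<delta> x y * \<delta> y x = 1\<close>. Its diagonal is a character of \<open>J/2J\<close>; every such
  character occurs, and once it is divided out the remainder is alternating. Finally,
  \<open>\<psi> x y / \<psi> y x\<close> identifies \<open>H\<^sup>2(J; T)\<close> with the alternating bicharacters: injectively because
  symmetric cocycles are coboundaries (characters extend, the circle being divisible), surjectively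
  by decomposing \<open>J\<close> into cyclic summands.\<close>

text \<open>In additive notation put h = g - j and h' = g' - j'. Expanding B(h, h') turns B(g, g') =
  B(h, h') into B(g, j') + B(g', j) = B(j, j'); this is where the equation for \<beta> comes from.
  So \<beta> is a bilinear half of B, and the obstacle is division by two. Away from the diagonal it
  costs nothing, because \<beta> need not be symmetric: for a cyclic decomposition of J a mixed
  value of B can be given entirely to one order of the arguments. At a generator x, however, B(x, x)
  must be the square of a root of unity whose order divides that of x. For even order a primitive
  B(x, x) is no such square, and this is exactly the quaternionic case. The resulting bijection is
  not canonical. It depends on one \<beta> chosen for each J as an origin for all others, and on the
  way a bicharacter is attached to a prescribed diagonal.\<close>

definition character :: "('a, 'b) monoid_scheme \<Rightarrow> 'a set \<Rightarrow> ('a \<Rightarrow> complex) \<Rightarrow> bool" where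
  "character G H \<eta> \<longleftrightarrow> (\<forall>x\<in>H. \<eta> x \<in> circle) \<and> (\<forall>x\<in>H. \<forall>y\<in>H. \<eta> (x \<otimes>\<^bsub>G\<^esub> y) = \<eta> x * \<eta> y)"

section \<open>The circle group; characters of subgroups and their extension\<close>

lemma circle_one [simp]: "1 \<in> circle"
  and circle_mult: "z \<in> circle \<Longrightarrow> w \<in> circle \<Longrightarrow> z * w \<in> circle"
  and circle_divide: "z \<in> circle \<Longrightarrow> w \<in> circle \<Longrightarrow> z / w \<in> circle"
  and circle_inverse: "z \<in> circle \<Longrightarrow> inverse z \<in> circle"
  and circle_power: "z \<in> circle \<Longrightarrow> z ^ n \<in> circle"
  and circle_power_int: "z \<in> circle \<Longrightarrow> z powi k \<in> circle"
  and circle_nonzero: "z \<in> circle \<Longrightarrow> z \<noteq> 0"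
  and circle_cnj: "z \<in> circle \<Longrightarrow> cnj z = inverse z"
  by (auto simp: circle_def norm_mult norm_divide norm_inverse norm_power norm_power_int
      inverse_eq_divide divide_conv_cnj)

lemma circle_root:
  assumes "z \<in> circle" "0 < n"
  obtains w where "w \<in> circle" "w ^ n = z"
proof
  show "cis (Arg z / n) \<in> circle"
    by (simp add: circle_def)
  have "z \<noteq> 0" and "cmod z = 1"
    using assms by (auto simp: circle_def)
  then have "cis (Arg z) = z"
    by (simp add: cis_Arg sgn_eq)
  moreover have "cis (Arg z / n) ^ n = cis (Arg z)"
    using assms(2) by (simp only: Complex.DeMoivre) simp
  ultimately show "cis (Arg z / n) ^ n = z"
    by simp
qed

lemma character_circle: "character G H \<eta> \<Longrightarrow> x \<in> H \<Longrightarrow> \<eta> x \<in> circle"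
  by (simp add: character_def)

lemma character_nonzero: "character G H \<eta> \<Longrightarrow> x \<in> H \<Longrightarrow> \<eta> x \<noteq> 0"
  using character_circle circle_nonzero by metis

lemma character_mult:
  "character G H \<eta> \<Longrightarrow> x \<in> H \<Longrightarrow> y \<in> H \<Longrightarrow> \<eta> (x \<otimes>\<^bsub>G\<^esub> y) = \<eta> x * \<eta> y"
  by (simp add: character_def)

lemma character_subset: "character G H \<eta> \<Longrightarrow> K \<subseteq> H \<Longrightarrow> character G K \<eta>"
  by (auto simp: character_def)

context group
begin

lemma character_one:
  assumes "subgroup H G" "character G H \<eta>"
  shows "\<eta> \<one> = 1"
proof -
  have "\<one> \<in> H"
    using assms subgroup.one_closed by blast
  then have "\<eta> \<one> = \<eta> \<one> * \<eta> \<one>" and "\<eta> \<one> \<noteq> 0"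
    using character_mult[OF assms(2), of \<one> \<one>] character_nonzero[OF assms(2)] by auto
  then show ?thesis
    by simp
qed

lemma character_inv:
  assumes "subgroup H G" "character G H \<eta>" "x \<in> H"
  shows "\<eta> (inv x) = inverse (\<eta> x)"
proof -
  have x: "x \<in> carrier G" and inv: "inv x \<in> H"
    using assms subgroup.mem_carrier subgroup.m_inv_closed by metis+
  have "\<eta> x * \<eta> (inv x) = 1"
    using character_mult[OF assms(2,3) inv] x character_one[OF assms(1,2)] by simp
  then show ?thesis
    by (metis inverse_unique)
qed

lemma character_nat_pow:
  assumes "subgroup H G" "character G H \<eta>" "x \<in> H"
  shows "\<eta> (x [^] (n::nat)) = \<eta> x ^ n"
proof (induction n)
  case 0
  show ?case
    using assms character_one by simp
next
  case (Suc n)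
  have "x [^] n \<in> H"
    using assms by (metis subgroup_int_pow_closed int_pow_int)
  then show ?case
    using Suc character_mult[OF assms(2)] assms by simp
qed

lemma character_int_pow:
  assumes "subgroup H G" "character G H \<eta>" "x \<in> H"
  shows "\<eta> (x [^] (k::int)) = \<eta> x powi k"
proof -
  have x: "x \<in> carrier G"
    using assms subgroup.mem_carrier by metis
  have n: "x [^] n \<in> H" for n :: nat
    using assms by (metis subgroup_int_pow_closed int_pow_int)
  show ?thesis
    unfolding int_pow_def2 power_int_def
    by (auto simp: character_nat_pow[OF assms] character_inv[OF assms(1,2) n] power_inverse
        simp del: pow_nat)
qed

end

text \<open>Everything rests on a value \<zeta> for \<open>x\<close> that agrees with \<eta> on the
  powers of \<open>x\<close> inside \<open>H\<close>. If some positive power lies in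
  \<open>H\<close>, the exponents of such powers are the multiples of a least one, \<open>m\<close>,
  and \<zeta> can be any \<open>m\<close>-th root of \<open>\<eta> (x [^] m)\<close>. Otherwise only
  exponent 0 leads into \<open>H\<close>, and 1 is taken.\<close>

lemma (in comm_group) character_extend_step:
  assumes H: "subgroup H G" and \<eta>: "character G H \<eta>" and x: "x \<in> carrier G"
  obtains H' \<eta>' where "subgroup H' G" "H \<subseteq> H'" "x \<in> H'" "character G H' \<eta>'"
    "\<And>h. h \<in> H \<Longrightarrow> \<eta>' h = \<eta> h"
proof -
  note Hc = subgroup.mem_carrier[OF H]
  have pow: "x [^] (k::int) \<in> carrier G" for k
    using x by simp
  have "\<exists>\<zeta>\<in>circle. \<forall>k::int. x [^] k \<in> H \<longrightarrow> \<eta> (x [^] k) = \<zeta> powi k"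
  proof (cases "\<exists>m::nat. 0 < m \<and> x [^] m \<in> H")
    case True
    define m where "m = (LEAST m::nat. 0 < m \<and> x [^] m \<in> H)"
    have m: "0 < m" "x [^] m \<in> H"
      using LeastI_ex[OF True] by (auto simp: m_def)
    have min: "r = 0" if "x [^] r \<in> H" "r < m" for r :: nat
      using not_less_Least[of r "\<lambda>m. 0 < m \<and> x [^] m \<in> H"] that by (auto simp: m_def)
    obtain \<zeta> where \<zeta>: "\<zeta> \<in> circle" "\<zeta> ^ m = \<eta> (x [^] m)"
      using circle_root[OF character_circle[OF \<eta> m(2)] m(1)] by metis
    have "\<eta> (x [^] k) = \<zeta> powi k" if k: "x [^] k \<in> H" for k :: int
    proof -
      define q r where "q = k div int m" and "r = nat (k mod int m)"
      have r: "r < m" "int r = k - int m * q"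
        using m(1) by (auto simp: r_def q_def minus_mult_div_eq_mod nat_less_iff)
      have mq: "(x [^] m) [^] q = x [^] (int m * q)"
        using x by (simp add: int_pow_pow int_pow_int[symmetric])
      have "x [^] r = x [^] k \<otimes> inv ((x [^] m) [^] q)"
        using x unfolding mq by (simp add: int_pow_int[symmetric] r int_pow_diff)
      also have "\<dots> \<in> H"
        by (intro subgroup.m_closed[OF H] subgroup.m_inv_closed[OF H] subgroup_int_pow_closed[OF H] k m)
      finally have "r = 0"
        using min r by blast
      then have kq: "k = int m * q"
        using r by simp
      show ?thesis
        unfolding kq mq[symmetric] character_int_pow[OF H \<eta> m(2)] \<zeta>(2)[symmetric]
        by (simp add: power_int_mult)
    qed
    then show ?thesis
      using \<zeta>(1) by blast
  next
    case False
    have "k = 0" if "x [^] k \<in> H" for k :: int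
    proof (rule ccontr)
      assume "k \<noteq> 0"
      have "x [^] \<bar>k\<bar> \<in> H"
        using that subgroup.m_inv_closed[OF H that] x by (cases "k \<ge> 0") (auto simp: int_pow_neg)
      then have "x [^] (nat \<bar>k\<bar>) \<in> H"
        using int_pow_int[of G x "nat \<bar>k\<bar>"] by simp
      then show False
        using False \<open>k \<noteq> 0\<close> by (metis zero_less_abs_iff zero_less_nat_eq)
    qed
    then have "\<eta> (x [^] k) = 1" if "x [^] k \<in> H" for k :: int
      using character_one[OF H \<eta>] that by force
    then show ?thesis
      by (intro bexI[of _ 1]) auto
  qed
  then obtain \<zeta> where \<zeta>: "\<zeta> \<in> circle"
    and \<zeta>_eq: "\<And>k::int. x [^] k \<in> H \<Longrightarrow> \<eta> (x [^] k) = \<zeta> powi k"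
    by blast
  have \<zeta>0: "\<zeta> \<noteq> 0"
    using \<zeta> circle_nonzero by blast
  have unique: "\<eta> h * \<zeta> powi k = \<eta> h' * \<zeta> powi l"
    if h: "h \<in> H" "h' \<in> H" and eq: "h \<otimes> x [^] k = h' \<otimes> x [^] l" for h h' and k l :: int
  proof -
    have xkl: "x [^] (k - l) = h' \<otimes> inv h"
    proof -
      have "h \<otimes> (x [^] (k - l)) \<otimes> x [^] l = h \<otimes> x [^] k"
        using x Hc[OF h(1)] by (simp add: m_assoc int_pow_mult[symmetric])
      also have "\<dots> = h' \<otimes> x [^] l"
        by (rule eq)
      finally have "h \<otimes> (x [^] (k - l)) = h'"
        using x Hc h by simp
      then show ?thesis
        using x Hc h by (metis inv_solve_right m_comm pow)
    qed
    then have "x [^] (k - l) \<in> H"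
      using h H by (simp add: subgroup.m_closed subgroup.m_inv_closed)
    then have "\<zeta> powi (k - l) = \<eta> h' * inverse (\<eta> h)"
      using \<zeta>_eq xkl character_mult[OF \<eta> h(2)] character_inv[OF H \<eta> h(1)]
        subgroup.m_inv_closed[OF H h(1)] by metis
    then show ?thesis
      using \<zeta>0 character_nonzero[OF \<eta> h(1)] by (simp add: power_int_diff field_simps)
  qed
  define H' where "H' = {h \<otimes> x [^] k | h (k::int). h \<in> H}"
  \<comment> \<open>\<open>THE\<close> is legitimate by \<open>unique\<close>: two expressions of
    one element differ by a power of \<open>x\<close> lying in \<open>H\<close>, where \<zeta> and
    \<eta> agree.\<close>
  define \<eta>' where "\<eta>' y = (THE z. \<exists>h\<in>H. \<exists>k::int. y = h \<otimes> x [^] k \<and> z = \<eta> h * \<zeta> powi k)" for y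
  have \<eta>'_eq: "\<eta>' (h \<otimes> x [^] k) = \<eta> h * \<zeta> powi k" if "h \<in> H" for h and k :: int
    unfolding \<eta>'_def
  proof (rule the_equality)
    show "z = \<eta> h * \<zeta> powi k"
      if "\<exists>h'\<in>H. \<exists>l::int. h \<otimes> x [^] k = h' \<otimes> x [^] l \<and> z = \<eta> h' * \<zeta> powi l" for z
      using that unique[OF \<open>h \<in> H\<close>] by metis
  qed (use that in blast)
  have prod: "(h \<otimes> x [^] k) \<otimes> (h' \<otimes> x [^] l) = (h \<otimes> h') \<otimes> x [^] (k + l)"
    if "h \<in> H" "h' \<in> H" for h h' and k l :: int
    using that Hc x by (simp add: int_pow_mult m_ac)
  show thesis
  proof
    show "subgroup H' G"
    proof (rule subgroupI)
      show "H' \<subseteq> carrier G"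
        using Hc x by (auto simp: H'_def)
      show "H' \<noteq> {}"
        using subgroup.one_closed[OF H] by (auto simp: H'_def)
      show "inv a \<in> H'" if a: "a \<in> H'" for a
      proof -
        obtain h k where hk: "h \<in> H" "a = h \<otimes> x [^] (k::int)"
          using a by (auto simp: H'_def)
        then have "inv a = inv h \<otimes> x [^] (-k)"
          using Hc x by (simp add: inv_mult int_pow_neg)
        then show ?thesis
          using subgroup.m_inv_closed[OF H hk(1)] by (auto simp: H'_def)
      qed
      show "a \<otimes> b \<in> H'" if "a \<in> H'" "b \<in> H'" for a b
        using that prod subgroup.m_closed[OF H] unfolding H'_def by blast
    qed
    have "h = h \<otimes> x [^] (0::int)" if "h \<in> H" for h
      using Hc that by simp
    then show "H \<subseteq> H'"
      unfolding H'_def by blast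
    have "x = \<one> \<otimes> x [^] (1::int)"
      using x by simp
    then show "x \<in> H'"
      using subgroup.one_closed[OF H] unfolding H'_def by blast
    show "character G H' \<eta>'"
      unfolding character_def
    proof (intro conjI ballI)
      show "\<eta>' a \<in> circle" if "a \<in> H'" for a
        using that \<zeta> character_circle[OF \<eta>]
        by (auto simp: H'_def \<eta>'_eq circle_mult circle_power_int)
      show "\<eta>' (a \<otimes> b) = \<eta>' a * \<eta>' b" if ab: "a \<in> H'" "b \<in> H'" for a b
      proof -
        obtain h k h' l where h: "h \<in> H" "h' \<in> H"
          and "a = h \<otimes> x [^] (k::int)" "b = h' \<otimes> x [^] (l::int)"
          using ab by (auto simp: H'_def)
        then show ?thesis
          using \<zeta>0 by (simp add: prod \<eta>'_eq subgroup.m_closed[OF H] character_mult[OF \<eta>] power_int_add)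
      qed
    qed
    show "\<eta>' h = \<eta> h" if "h \<in> H" for h
      using \<eta>'_eq[OF that, of 0] Hc that by simp
  qed
qed

text \<open>Iterates the one-element extension over \<open>S\<close>. Generation by \<open>H\<close>
  and a finite \<open>S\<close> is assumed, rather than a finite carrier, because one application is
  to an extension of a finite group by the circle.\<close>

lemma (in comm_group) character_extend:
  assumes "finite S" and "S \<subseteq> carrier G" and "subgroup H G" and "character G H \<eta>"
    and gen: "\<And>K. subgroup K G \<Longrightarrow> H \<subseteq> K \<Longrightarrow> S \<subseteq> K \<Longrightarrow> K = carrier G"
  obtains \<eta>' where "character G (carrier G) \<eta>'" "\<And>h. h \<in> H \<Longrightarrow> \<eta>' h = \<eta> h"
proof -
  have "\<exists>K \<eta>'. subgroup K G \<and> H \<subseteq> K \<and> S \<subseteq> K \<and> character G K \<eta>' \<and> (\<forall>h\<in>H. \<eta>' h = \<eta> h)"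
    using assms(1,2)
  proof (induction S)
    case empty
    then show ?case
      using assms(3,4) by blast
  next
    case (insert x S)
    then obtain K \<eta>' where K: "subgroup K G" "H \<subseteq> K" "S \<subseteq> K" "character G K \<eta>'"
      "\<forall>h\<in>H. \<eta>' h = \<eta> h"
      by auto
    obtain K' \<eta>'' where K': "subgroup K' G" "K \<subseteq> K'" "x \<in> K'" "character G K' \<eta>''"
      "\<And>h. h \<in> K \<Longrightarrow> \<eta>'' h = \<eta>' h"
      using character_extend_step[OF K(1,4), of x] insert.prems by auto
    show ?case
      using K K' by (intro exI[of _ K'] exI[of _ \<eta>'']) auto
  qed
  then show thesis
    using gen that by metis
qed

section \<open>Symmetric cocycles are coboundaries\<close>

definition cocycle_on :: "('a, 'b) monoid_scheme \<Rightarrow> 'a set \<Rightarrow> ('a \<Rightarrow> 'a \<Rightarrow> complex) \<Rightarrow> bool" where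
  "cocycle_on G J \<psi> \<longleftrightarrow> (\<forall>a\<in>J. \<forall>b\<in>J. \<psi> a b \<in> circle)
     \<and> (\<forall>a\<in>J. \<forall>b\<in>J. \<forall>c\<in>J. \<psi> b c * \<psi> a (b \<otimes>\<^bsub>G\<^esub> c) = \<psi> (a \<otimes>\<^bsub>G\<^esub> b) c * \<psi> a b)"

text \<open>\<psi> turns the product of the circle with \<open>G\<close> into a central extension
  \<open>E\<close>, which is abelian since \<psi> is symmetric. The identity character of the
  embedded circle extends to all of \<open>E\<close>, and its values at the pairs
  \<open>(1, a)\<close> split \<psi>.\<close>

lemma (in comm_group) symmetric_cocycle_coboundary:
  assumes fin: "finite (carrier G)" and coc: "cocycle_on G (carrier G) \<psi>"
    and sym: "\<And>a b. a \<in> carrier G \<Longrightarrow> b \<in> carrier G \<Longrightarrow> \<psi> a b = \<psi> b a"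
  obtains f where "\<And>a. a \<in> carrier G \<Longrightarrow> f a \<in> circle"
    "\<And>a b. a \<in> carrier G \<Longrightarrow> b \<in> carrier G \<Longrightarrow> \<psi> a b = f a * f b / f (a \<otimes> b)"
proof -
  \<comment> \<open>As \<psi> is not assumed normalised, only
    \<open>\<psi> \<one> a = \<psi> \<one> \<one>\<close> is available, and the neutral element has
    first component \<open>inverse (\<psi> \<one> \<one>)\<close>.\<close>
  define E where "E = \<lparr>carrier = circle \<times> carrier G,
    monoid.mult = (\<lambda>u v. (fst u * fst v * \<psi> (snd u) (snd v), snd u \<otimes> snd v)),
    one = (inverse (\<psi> \<one> \<one>), \<one>)\<rparr>"
  have carE: "carrier E = circle \<times> carrier G"
    and mulE: "u \<otimes>\<^bsub>E\<^esub> v = (fst u * fst v * \<psi> (snd u) (snd v), snd u \<otimes> snd v)"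
    and oneE: "\<one>\<^bsub>E\<^esub> = (inverse (\<psi> \<one> \<one>), \<one>)" for u v
    by (simp_all add: E_def)
  have \<psi>: "\<psi> a b \<in> circle" if "a \<in> carrier G" "b \<in> carrier G" for a b
    using coc that by (auto simp: cocycle_on_def)
  have \<psi>0: "\<psi> a b \<noteq> 0" if "a \<in> carrier G" "b \<in> carrier G" for a b
    using \<psi>[OF that] circle_nonzero by blast
  have eq: "\<psi> b c * \<psi> a (b \<otimes> c) = \<psi> (a \<otimes> b) c * \<psi> a b"
    if "a \<in> carrier G" "b \<in> carrier G" "c \<in> carrier G" for a b c
    using coc that by (auto simp: cocycle_on_def)
  have \<psi>1: "\<psi> \<one> a = \<psi> \<one> \<one>" if "a \<in> carrier G" for a
    using eq[of \<one> \<one> a] that \<psi>0[of \<one> a] by simp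
  interpret E: comm_group E
  proof (rule comm_groupI)
    fix u v w
    assume u: "u \<in> carrier E" and v: "v \<in> carrier E" and w: "w \<in> carrier E"
    show "u \<otimes>\<^bsub>E\<^esub> v \<in> carrier E"
      using u v \<psi> by (auto simp: carE mulE circle_mult)
    show "u \<otimes>\<^bsub>E\<^esub> v \<otimes>\<^bsub>E\<^esub> w = u \<otimes>\<^bsub>E\<^esub> (v \<otimes>\<^bsub>E\<^esub> w)"
      using u v w eq[of "snd u" "snd v" "snd w"] by (auto simp: carE mulE m_assoc)
    show "u \<otimes>\<^bsub>E\<^esub> v = v \<otimes>\<^bsub>E\<^esub> u"
      using u v sym by (auto simp: carE mulE m_comm)
  next
    show "\<one>\<^bsub>E\<^esub> \<in> carrier E"
      using \<psi>[of \<one> \<one>] by (simp add: carE oneE circle_inverse)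
  next
    fix u assume u: "u \<in> carrier E"
    show "\<one>\<^bsub>E\<^esub> \<otimes>\<^bsub>E\<^esub> u = u"
      using u \<psi>1[of "snd u"] \<psi>0[of \<one> \<one>] by (auto simp: carE oneE mulE)
    define a where "a = snd u"
    have a: "a \<in> carrier G" "fst u \<in> circle"
      using u by (auto simp: carE a_def)
    define v where "v = (inverse (fst u * \<psi> (inv a) a * \<psi> \<one> \<one>), inv a)"
    have "v \<in> carrier E"
      using a \<psi> by (auto simp: carE v_def intro!: circle_inverse circle_mult)
    moreover have "v \<otimes>\<^bsub>E\<^esub> u = \<one>\<^bsub>E\<^esub>"
      using a circle_nonzero[OF a(2)] \<psi>0[of "inv a" a] \<psi>0[of \<one> \<one>]
      by (auto simp: mulE oneE v_def a_def[symmetric] field_simps)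
    ultimately show "\<exists>v\<in>carrier E. v \<otimes>\<^bsub>E\<^esub> u = \<one>\<^bsub>E\<^esub>"
      by blast
  qed
  define H where "H = circle \<times> {\<one>}"
  \<comment> \<open>Multiplication inside \<open>H\<close> also picks up a factor
    \<open>\<psi> \<one> \<one>\<close>; rescaling by it turns the first component into a
    homomorphism.\<close>
  define \<eta> where "\<eta> u = fst u * \<psi> \<one> \<one>" for u :: "complex \<times> 'a"
  have HE: "subgroup H E"
  proof (rule E.subgroupI)
    show "inv\<^bsub>E\<^esub> u \<in> H" if u: "u \<in> H" for u
    proof -
      define v where "v = (inverse (fst u * \<psi> \<one> \<one> * \<psi> \<one> \<one>), \<one>)"
      have "v \<otimes>\<^bsub>E\<^esub> u = \<one>\<^bsub>E\<^esub>" "v \<in> carrier E" "u \<in> carrier E" "v \<in> H"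
        using u \<psi>[of \<one> \<one>] \<psi>0[of \<one> \<one>]
        by (auto simp: H_def v_def mulE oneE carE circle_nonzero field_simps
            intro!: circle_inverse circle_mult circle_divide)
      then show ?thesis
        using E.inv_equality by metis
    qed
  qed (use \<psi>[of \<one> \<one>] circle_one in \<open>auto simp: H_def carE mulE circle_mult\<close>)
  have \<eta>: "character E H \<eta>"
    using \<psi>[of \<one> \<one>] by (auto simp: character_def H_def \<eta>_def mulE circle_mult)
  have "finite ({1} \<times> carrier G)"
    using fin by simp
  moreover have "{1} \<times> carrier G \<subseteq> carrier E"
    by (auto simp: carE)
  moreover have "K = carrier E" if K: "subgroup K E" "H \<subseteq> K" "{1} \<times> carrier G \<subseteq> K" for K
  proof
    show "K \<subseteq> carrier E"
      using K(1) by (rule subgroup.subset)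
    show "carrier E \<subseteq> K"
    proof
      fix u assume u: "u \<in> carrier E"
      then have "u = (fst u / \<psi> \<one> \<one>, \<one>) \<otimes>\<^bsub>E\<^esub> (1, snd u)"
        using \<psi>1[of "snd u"] \<psi>0[of \<one> \<one>] by (auto simp: carE mulE)
      moreover have "(fst u / \<psi> \<one> \<one>, \<one>) \<in> K" "(1, snd u) \<in> K"
        using u K(2,3) \<psi>[of \<one> \<one>] by (auto simp: carE H_def circle_divide)
      ultimately show "u \<in> K"
        using subgroup.m_closed[OF K(1)] by metis
    qed
  qed
  ultimately obtain \<eta>' where \<eta>': "character E (carrier E) \<eta>'" "\<And>u. u \<in> H \<Longrightarrow> \<eta>' u = \<eta> u"
    using E.character_extend[OF _ _ HE \<eta>] by metis
  define f where "f a = \<eta>' (1, a)" for a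
  have f: "f a \<in> circle" if "a \<in> carrier G" for a
    using character_circle[OF \<eta>'(1)] that by (auto simp: f_def carE)
  moreover have "\<psi> a b = f a * f b / f (a \<otimes> b)" if ab: "a \<in> carrier G" "b \<in> carrier G" for a b
  proof -
    have c: "(1, a) \<in> carrier E" "(1, b) \<in> carrier E" "(1, a \<otimes> b) \<in> carrier E"
      "(\<psi> a b / \<psi> \<one> \<one>, \<one>) \<in> H" "(\<psi> a b / \<psi> \<one> \<one>, \<one>) \<in> carrier E"
      using ab \<psi> by (auto simp: carE H_def intro!: circle_divide)
    have "f a * f b = \<eta>' ((1, a) \<otimes>\<^bsub>E\<^esub> (1, b))"
      using character_mult[OF \<eta>'(1) c(1,2)] by (simp add: f_def)
    also have "(1, a) \<otimes>\<^bsub>E\<^esub> (1, b) = (\<psi> a b / \<psi> \<one> \<one>, \<one>) \<otimes>\<^bsub>E\<^esub> (1, a \<otimes> b)"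
      using ab \<psi>1[of "a \<otimes> b"] \<psi>0[of \<one> \<one>] by (simp add: mulE)
    also have "\<eta>' \<dots> = \<psi> a b * f (a \<otimes> b)"
      using character_mult[OF \<eta>'(1) c(5,3)] \<eta>'(2)[OF c(4)] \<psi>0[of \<one> \<one>] by (simp add: \<eta>_def f_def)
    finally show ?thesis
      using circle_nonzero[OF f, of "a \<otimes> b"] ab by (simp add: field_simps)
  qed
  ultimately show thesis
    using that by blast
qed

section \<open>Elements of maximal order and cyclic summands\<close>

context comm_group
begin

lemma ord_mult_coprime:
  assumes x: "x \<in> carrier G" and y: "y \<in> carrier G" and cop: "coprime (ord x) (ord y)"
  shows "ord (x \<otimes> y) = ord x * ord y"
proof (rule dvd_antisym)
  show "ord (x \<otimes> y) dvd ord x * ord y"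
    using x y by (rule abelian_ord_mul_divides)
  have *: "ord x dvd ord (x \<otimes> y)"
    if x: "x \<in> carrier G" and y: "y \<in> carrier G" and cop: "coprime (ord x) (ord y)" for x y
  proof -
    define k where "k = ord (x \<otimes> y) * ord y"
    have "x [^] k \<otimes> y [^] k = (x \<otimes> y) [^] k"
      using x y by (simp add: nat_pow_distrib)
    also have "\<dots> = \<one>"
      using x y by (subst pow_eq_id) (auto simp: k_def)
    finally have "x [^] k \<otimes> y [^] k = \<one>" .
    moreover have "y [^] k = \<one>"
      using y by (simp add: pow_eq_id k_def)
    ultimately have "x [^] k = \<one>"
      using x by simp
    then show ?thesis
      using x cop by (simp add: pow_eq_id k_def coprime_dvd_mult_left_iff)
  qed
  show "ord x * ord y dvd ord (x \<otimes> y)"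
    using *[OF x y cop] *[OF y x] cop x y by (simp add: divides_mult m_comm coprime_commute)
qed

text \<open>If a prime \<open>p\<close> had a larger exponent in \<open>ord y\<close> than in
  \<open>ord x\<close>, then killing the \<open>p\<close>-part of \<open>x\<close> and the
  prime-to-\<open>p\<close> part of \<open>y\<close> would leave elements of coprime orders whose
  product has order larger than \<open>ord x\<close>.\<close>

lemma ord_dvd_max_ord:
  assumes fin: "finite (carrier G)" and J: "subgroup J G" and x: "x \<in> J"
    and max: "\<And>y. y \<in> J \<Longrightarrow> ord y \<le> ord x" and y: "y \<in> J"
  shows "ord y dvd ord x"
proof (rule ccontr)
  assume not: "\<not> ord y dvd ord x"
  have c: "x \<in> carrier G" "y \<in> carrier G"
    using J x y subgroup.mem_carrier by metis+
  then have pos: "0 < ord x" "0 < ord y"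
    using ord_ge_1[OF fin] by force+
  obtain p where p: "prime p" "multiplicity p (ord x) < multiplicity p (ord y)"
    using multiplicity_le_imp_dvd[of "ord y" "ord x"] not pos by (metis not_le not_gr_zero)
  define a b where "a = multiplicity p (ord y)" and "b = multiplicity p (ord x)"
  obtain n' where n': "ord x = p ^ b * n'" "\<not> p dvd n'"
    using multiplicity_decompose'[of "ord x" p] p(1) pos not_prime_unit unfolding b_def by (metis not_gr_zero)
  obtain m' where m': "ord y = p ^ a * m'" "\<not> p dvd m'"
    using multiplicity_decompose'[of "ord y" p] p(1) pos not_prime_unit unfolding a_def by (metis not_gr_zero)
  define x' y' where "x' = x [^] (p ^ b)" and "y' = y [^] m'"
  have c': "x' \<in> carrier G" "y' \<in> carrier G"
    using c by (auto simp: x'_def y'_def)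
  have ne: "p ^ b \<noteq> 0" "m' \<noteq> 0" "p \<noteq> 0"
    using p m' pos by (auto intro!: Nat.gr0I)
  have x'_ord: "ord x' = n'"
    using ord_pow[OF c(1), of "p ^ b"] n' ne by (simp add: x'_def)
  have y'_ord: "ord y' = p ^ a"
    using ord_pow[OF c(2), of m'] m' ne by (simp add: y'_def)
  have "coprime n' (p ^ a)"
    using prime_imp_coprime[OF p(1) n'(2)] by (simp add: coprime_commute)
  then have "ord (x' \<otimes> y') = n' * p ^ a"
    using ord_mult_coprime[OF c'] by (simp add: x'_ord y'_ord)
  moreover have "x' \<otimes> y' \<in> J"
    using x y J subgroup_int_pow_closed[OF J] unfolding x'_def y'_def
    by (metis int_pow_int subgroup.m_closed)
  ultimately have "n' * p ^ a \<le> p ^ b * n'"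
    using max n' by metis
  moreover have "n' > 0"
    using n' pos by (auto intro!: Nat.gr0I)
  ultimately have "p ^ a \<le> p ^ b"
    by (simp add: mult.commute)
  then show False
    using p prime_gt_1_nat[OF p(1)] by (simp add: a_def b_def)
qed

end

text \<open>Exponents of \<zeta> serve as a logarithm on the \<open>n\<close>-th roots of unity,
  with values in the integers modulo \<open>n\<close>.\<close>

lemma primitive_root_exists:
  assumes "0 < n"
  obtains \<zeta> where "\<zeta> \<in> circle" "\<And>k::int. \<zeta> powi k = 1 \<longleftrightarrow> int n dvd k"
    "\<And>z. z ^ n = 1 \<Longrightarrow> \<exists>k::int. z = \<zeta> powi k"
proof
  define \<zeta> where "\<zeta> = cis (2 * pi / n)"
  note bij = Complex.bij_betw_roots_unity[OF assms]
  have pow: "\<zeta> ^ k = cis (2 * pi * real k / real n)" for k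
    by (simp add: \<zeta>_def Complex.DeMoivre mult_ac)
  have n: "\<zeta> ^ n = 1"
    using assms by (simp add: pow)
  show \<zeta>: "cis (2 * pi / n) \<in> circle"
    by (simp add: circle_def)
  then have 0: "\<zeta> \<noteq> 0"
    by (simp add: \<zeta>_def)
  have mod: "\<zeta> powi k = \<zeta> ^ (nat (k mod int n))" for k :: int
  proof -
    have "\<zeta> powi k = \<zeta> powi (int n * (k div int n) + int (nat (k mod int n)))"
      using assms by simp
    also have "\<dots> = \<zeta> powi (int n * (k div int n)) * \<zeta> powi int (nat (k mod int n))"
      using 0 by (subst power_int_add) auto
    also have "\<dots> = \<zeta> ^ (nat (k mod int n))"
      using n by (simp only: power_int_mult power_int_of_nat) simp
    finally show ?thesis .
  qed
  show "cis (2 * pi / n) powi k = 1 \<longleftrightarrow> int n dvd k" for k :: int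
  proof -
    have "nat (k mod int n) < n"
      using assms by (simp add: nat_less_iff)
    then have "\<zeta> ^ nat (k mod int n) = \<zeta> ^ 0 \<longleftrightarrow> nat (k mod int n) = 0"
      using bij assms unfolding pow bij_betw_def inj_on_def
      by (metis lessThan_iff)
    then show ?thesis
      using assms mod[of k] by (simp add: \<zeta>_def dvd_eq_mod_eq_0 nat_eq_iff)
  qed
  show "\<exists>k::int. z = cis (2 * pi / n) powi k" if z: "z ^ n = 1" for z
  proof -
    obtain k where "z = \<zeta> ^ k"
      using bij z unfolding pow[symmetric] bij_betw_def by blast
    then have "z = \<zeta> powi int k"
      by simp
    then show ?thesis
      unfolding \<zeta>_def by blast
  qed
qed

text \<open>An element \<open>x\<close> of maximal order generates a direct summand: the character
  sending \<open>x\<close> to a primitive root of unity of order \<open>ord x\<close> extends to the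
  whole group, and its kernel in \<open>J\<close> is a complement. The function \<open>e\<close> is
  a logarithm of that character; it picks integers, so it is additive only modulo
  \<open>ord x\<close>.\<close>

lemma (in comm_group) cyclic_summand:
  assumes fin: "finite (carrier G)" and J: "subgroup J G" and nontriv: "J \<noteq> {\<one>}"
  obtains x K e where "x \<in> J" "subgroup K G" "K \<subset> J"
    "\<And>y. y \<in> J \<Longrightarrow> y \<otimes> x [^] (- e y :: int) \<in> K"
    "\<And>y z. y \<in> J \<Longrightarrow> z \<in> J \<Longrightarrow> int (ord x) dvd e (y \<otimes> z) - (e y + e z)"
proof -
  note Jc = subgroup.mem_carrier[OF J]
  have finJ: "finite J"
    using fin J finite_subset subgroup.subset by metis
  have "J \<noteq> {}"
    using subgroup.one_closed[OF J] by auto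
  then have "Max (ord ` J) \<in> ord ` J"
    using finJ by (intro Max_in) auto
  then obtain x where x: "x \<in> J" and ord_x: "Max (ord ` J) = ord x"
    by blast
  have max: "ord y \<le> ord x" if "y \<in> J" for y
    using that finJ by (simp flip: ord_x)
  define n where "n = ord x"
  have n: "0 < n"
    using ord_ge_1[OF fin Jc[OF x]] by (simp add: n_def)
  have exp: "y [^] n = \<one>" if "y \<in> J" for y
    using ord_dvd_max_ord[OF fin J x max that] Jc[OF that] by (simp add: pow_eq_id n_def)
  obtain \<zeta> where \<zeta>: "\<zeta> \<in> circle" and prim: "\<And>k::int. \<zeta> powi k = 1 \<longleftrightarrow> int n dvd k"
    and roots: "\<And>z. z ^ n = 1 \<Longrightarrow> \<exists>k::int. z = \<zeta> powi k"
    using primitive_root_exists[OF n] by metis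
  have \<zeta>0: "\<zeta> \<noteq> 0"
    using \<zeta> circle_nonzero by blast
  have \<zeta>_eq: "\<zeta> powi k = \<zeta> powi l \<longleftrightarrow> int n dvd k - l" for k l :: int
    using prim[of "k - l"] \<zeta>0 by (simp add: power_int_diff)
  define H where "H = range (\<lambda>k::int. x [^] k)"
  define \<eta> where "\<eta> y = \<zeta> powi (SOME k::int. y = x [^] k)" for y
  have \<eta>_eq: "\<eta> (x [^] k) = \<zeta> powi k" for k :: int
  proof -
    define l where "l = (SOME l::int. x [^] k = x [^] l)"
    have "x [^] k = x [^] l"
      unfolding l_def by (rule someI) simp
    then have "int n dvd l - k"
      using int_pow_eq[OF Jc[OF x]] by (simp add: n_def)
    then show ?thesis
      using \<zeta>_eq[of l k] by (simp add: \<eta>_def l_def)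
  qed
  have HG: "subgroup H G"
  proof (rule subgroupI)
    fix a b assume "a \<in> H" "b \<in> H"
    then obtain k l :: int where kl: "a = x [^] k" "b = x [^] l"
      by (auto simp: H_def)
    then have "inv a = x [^] (-k)" "a \<otimes> b = x [^] (k + l)"
      using Jc[OF x] by (auto simp: int_pow_neg int_pow_mult)
    then show "inv a \<in> H" "a \<otimes> b \<in> H"
      by (auto simp: H_def)
  qed (use Jc[OF x] in \<open>auto simp: H_def\<close>)
  have H\<eta>: "character G H \<eta>"
    using \<zeta> \<zeta>0 Jc[OF x]
    by (auto simp: character_def H_def \<eta>_eq circle_power_int int_pow_mult[symmetric] power_int_add)
  have "L = carrier G" if "subgroup L G" "carrier G \<subseteq> L" for L
    using that subgroup.subset by blast
  then obtain \<eta>' where \<eta>': "character G (carrier G) \<eta>'" and ext: "\<And>h. h \<in> H \<Longrightarrow> \<eta>' h = \<eta> h"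
    using character_extend[OF fin order_refl HG H\<eta>] by blast
  note \<eta>'J = character_subset[OF \<eta>' subgroup.subset[OF J]]
  have \<eta>'x: "\<eta>' (x [^] k) = \<zeta> powi k" for k :: int
    using ext \<eta>_eq by (auto simp: H_def)
  have xk: "x [^] k \<in> J" for k :: int
    using subgroup_int_pow_closed[OF J x] .
  \<comment> \<open>Maximality of \<open>ord x\<close> enters here: it makes \<open>n\<close> an
    exponent of \<open>J\<close>, so the extended character takes only \<open>n\<close>-th roots of
    unity as values on \<open>J\<close>.\<close>
  have ex: "\<exists>k::int. \<eta>' y = \<zeta> powi k" if y: "y \<in> J" for y
    using character_nat_pow[OF J \<eta>'J y, of n] exp[OF y] character_one[OF J \<eta>'J]
    by (intro roots) simp
  define e where "e y = (SOME k::int. \<eta>' y = \<zeta> powi k)" for y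
  have e: "\<eta>' y = \<zeta> powi e y" if "y \<in> J" for y
    unfolding e_def using someI_ex[OF ex[OF that]] .
  define K where "K = {y \<in> J. \<eta>' y = 1}"
  have "1 < n"
  proof (rule ccontr)
    assume "\<not> 1 < n"
    then have "n = 1"
      using n by simp
    then have "y = \<one>" if "y \<in> J" for y
      using exp[OF that] Jc[OF that] by simp
    then show False
      using nontriv subgroup.one_closed[OF J] by blast
  qed
  show thesis
  proof
    show "x \<in> J"
      by (rule x)
    show "subgroup K G"
    proof (rule subgroupI)
      have "\<one> \<in> K"
        using character_one[OF J \<eta>'J] subgroup.one_closed[OF J] by (simp add: K_def)
      then show "K \<noteq> {}"
        by blast
    qed (use Jc in \<open>auto simp: K_def character_inv[OF J \<eta>'J] character_mult[OF \<eta>'J]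
        subgroup.m_closed[OF J] subgroup.m_inv_closed[OF J]\<close>)
    have "\<not> int n dvd 1"
      using \<open>1 < n\<close> by auto
    then have "x \<notin> K"
      using \<eta>'x[of 1] prim[of 1] Jc[OF x] by (auto simp: K_def)
    then show "K \<subset> J"
      using x by (auto simp: K_def)
    show "y \<otimes> x [^] (- e y) \<in> K" if y: "y \<in> J" for y
      using subgroup.m_closed[OF J y xk] character_mult[OF \<eta>'J y xk] e[OF y] \<zeta>0
      by (simp add: K_def \<eta>'x power_int_minus)
    show "int (ord x) dvd e (y \<otimes> z) - (e y + e z)" if yz: "y \<in> J" "z \<in> J" for y z
    proof -
      have "\<zeta> powi e (y \<otimes> z) = \<zeta> powi (e y + e z)"
        using character_mult[OF \<eta>'J yz] e yz \<zeta>0 subgroup.m_closed[OF J yz]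
        by (simp add: power_int_add)
      then show ?thesis
        using \<zeta>_eq by (simp add: n_def)
    qed
  qed
qed

section \<open>Bicharacters, their factorization, and cocycles\<close>

definition bicharacter :: "('a, 'b) monoid_scheme \<Rightarrow> 'a set \<Rightarrow> ('a \<Rightarrow> 'a \<Rightarrow> complex) \<Rightarrow> bool" where
  "bicharacter G J \<beta> \<longleftrightarrow> (\<forall>x\<in>J. character G J (\<beta> x)) \<and> (\<forall>y\<in>J. character G J (\<lambda>x. \<beta> x y))"

lemma bicharacter_right: "bicharacter G J \<beta> \<Longrightarrow> x \<in> J \<Longrightarrow> character G J (\<beta> x)"
  and bicharacter_left: "bicharacter G J \<beta> \<Longrightarrow> y \<in> J \<Longrightarrow> character G J (\<lambda>x. \<beta> x y)"
  by (simp_all add: bicharacter_def)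

lemma bicharacter_circle: "bicharacter G J \<beta> \<Longrightarrow> x \<in> J \<Longrightarrow> y \<in> J \<Longrightarrow> \<beta> x y \<in> circle"
  using character_circle[OF bicharacter_right] .

lemma bicharacter_nonzero: "bicharacter G J \<beta> \<Longrightarrow> x \<in> J \<Longrightarrow> y \<in> J \<Longrightarrow> \<beta> x y \<noteq> 0"
  using character_nonzero[OF bicharacter_right] .

lemma bicharacter_mult_left:
  "bicharacter G J \<beta> \<Longrightarrow> x \<in> J \<Longrightarrow> x' \<in> J \<Longrightarrow> y \<in> J \<Longrightarrow> \<beta> (x \<otimes>\<^bsub>G\<^esub> x') y = \<beta> x y * \<beta> x' y"
  using character_mult[OF bicharacter_left] .

lemma bicharacter_mult_right:
  "bicharacter G J \<beta> \<Longrightarrow> x \<in> J \<Longrightarrow> y \<in> J \<Longrightarrow> y' \<in> J \<Longrightarrow> \<beta> x (y \<otimes>\<^bsub>G\<^esub> y') = \<beta> x y * \<beta> x y'"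
  using character_mult[OF bicharacter_right] .

lemma bicharacterI:
  assumes "\<And>x y. x \<in> J \<Longrightarrow> y \<in> J \<Longrightarrow> \<beta> x y \<in> circle"
    and "\<And>x x' y. x \<in> J \<Longrightarrow> x' \<in> J \<Longrightarrow> y \<in> J \<Longrightarrow> \<beta> (x \<otimes>\<^bsub>G\<^esub> x') y = \<beta> x y * \<beta> x' y"
    and "\<And>x y y'. x \<in> J \<Longrightarrow> y \<in> J \<Longrightarrow> y' \<in> J \<Longrightarrow> \<beta> x (y \<otimes>\<^bsub>G\<^esub> y') = \<beta> x y * \<beta> x y'"
  shows "bicharacter G J \<beta>"
  using assms by (simp add: bicharacter_def character_def)

lemma bicharacter_subset: "bicharacter G J \<beta> \<Longrightarrow> K \<subseteq> J \<Longrightarrow> bicharacter G K \<beta>"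
  by (auto simp: bicharacter_def intro: character_subset)

lemma bicharacter_times:
  "bicharacter G J \<beta> \<Longrightarrow> bicharacter G J \<gamma> \<Longrightarrow> bicharacter G J (\<lambda>x y. \<beta> x y * \<gamma> x y)"
  by (auto intro!: bicharacterI circle_mult
      simp: bicharacter_circle bicharacter_mult_left bicharacter_mult_right)

lemma bicharacter_divide:
  "bicharacter G J \<beta> \<Longrightarrow> bicharacter G J \<gamma> \<Longrightarrow> bicharacter G J (\<lambda>x y. \<beta> x y / \<gamma> x y)"
  by (auto intro!: bicharacterI circle_divide
      simp: bicharacter_circle bicharacter_mult_left bicharacter_mult_right)

lemma power_int_cong_root_of_unity:
  fixes z :: complex
  assumes "z ^ n = 1" "int n dvd k - l"
  shows "z powi k = z powi l"
proof (cases "n = 0")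
  case False
  then have z: "z \<noteq> 0"
    using assms(1) by (auto simp: power_0_left)
  obtain q where q: "k = l + int n * q"
    using assms(2) by (metis dvdE diff_eq_eq add.commute)
  show ?thesis
    using z assms(1) by (simp add: q power_int_add power_int_mult)
qed (use assms in auto)

context comm_group
begin

text \<open>Symmetric and antisymmetric data are treated together: \<open>s\<close> is \<open>1\<close> or \<open>-1\<close>. The proof splits
  off a cyclic summand and takes \<open>\<beta>\<close> triangular with respect to the decomposition, so that only
  the diagonal value \<open>\<tau> x x\<close> at a generator has to be factored.\<close>
lemma bicharacter_factorization:
  fixes s :: int
  assumes fin: "finite (carrier G)" and J: "subgroup J G" and s: "s * s = 1"
    and \<tau>: "bicharacter G J \<tau>"
    and sym: "\<And>x y. x \<in> J \<Longrightarrow> y \<in> J \<Longrightarrow> \<tau> y x = \<tau> x y powi s"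
    and diag: "\<And>x. x \<in> J \<Longrightarrow> \<exists>\<zeta>\<in>circle. \<zeta> ^ ord x = 1 \<and> \<zeta> * \<zeta> powi s = \<tau> x x"
  shows "\<exists>\<beta>. bicharacter G J \<beta> \<and> (\<forall>x\<in>J. \<forall>y\<in>J. \<beta> x y * \<beta> y x powi s = \<tau> x y)"
  using J \<tau> sym diag
proof (induction "card J" arbitrary: J rule: less_induct)
  case less
  note J = less.prems(1) and \<tau> = less.prems(2) and sym = less.prems(3) and diag = less.prems(4)
  note Jc = subgroup.mem_carrier[OF J]
  show ?case
  proof (cases "J = {\<one>}")
    case True
    have "\<tau> \<one> \<one> = 1"
      using character_one[OF J bicharacter_right[OF \<tau>]] True by simp
    then show ?thesis
      using True by (intro exI[of _ "\<lambda>_ _. 1"]) (simp add: bicharacter_def character_def)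
  next
    case False
    obtain x K e where x: "x \<in> J" and K: "subgroup K G" "K \<subset> J"
      and p_in: "\<And>y. y \<in> J \<Longrightarrow> y \<otimes> x [^] (- e y :: int) \<in> K"
      and e: "\<And>y z. y \<in> J \<Longrightarrow> z \<in> J \<Longrightarrow> int (ord x) dvd e (y \<otimes> z) - (e y + e z)"
      using cyclic_summand[OF fin J False] by metis
    have finJ: "finite J"
      using fin subgroup.subset[OF J] finite_subset by blast
    have KJ: "K \<subseteq> J"
      using K(2) by blast
    define n where "n = ord x"
    define p where "p y = y \<otimes> x [^] (- e y)" for y
    have pK: "p y \<in> K" and pJ: "p y \<in> J" if "y \<in> J" for y
      using p_in[OF that] KJ by (auto simp: p_def)
    have xk: "x [^] k \<in> J" for k :: int
      using subgroup_int_pow_closed[OF J x] .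
    have xc: "x \<in> carrier G"
      using Jc x .
    have p_mult: "p (y \<otimes> z) = p y \<otimes> p z" if yz: "y \<in> J" "z \<in> J" for y z
    proof -
      have "int (ord x) dvd - (e y + e z) - - e (y \<otimes> z)"
        using e[OF yz] by (simp add: algebra_simps)
      then have "x [^] (- e (y \<otimes> z)) = x [^] (- (e y + e z))"
        by (subst int_pow_eq[OF xc])
      also have "\<dots> = x [^] (- e y) \<otimes> x [^] (- e z)"
        by (simp add: int_pow_mult[OF xc, symmetric])
      finally show ?thesis
        using Jc yz xc by (simp add: p_def m_ac)
    qed
    have p_eq: "p y \<otimes> x [^] e y = y" if "y \<in> J" for y
      using Jc[OF that] xc by (simp add: p_def m_assoc int_pow_mult[symmetric])
    have "card K < card J"
      using K(2) finJ by (simp add: psubset_card_mono)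
    then obtain \<beta>K where \<beta>K: "bicharacter G K \<beta>K"
      and \<beta>K_eq: "\<And>y z. y \<in> K \<Longrightarrow> z \<in> K \<Longrightarrow> \<beta>K y z * \<beta>K z y powi s = \<tau> y z"
      using less.hyps[OF _ K(1) bicharacter_subset[OF \<tau> KJ] sym diag] KJ by (metis subsetD)
    obtain \<zeta> where \<zeta>: "\<zeta> \<in> circle" "\<zeta> ^ n = 1" "\<zeta> * \<zeta> powi s = \<tau> x x"
      using diag[OF x] by (auto simp: n_def)
    have \<zeta>0: "\<zeta> \<noteq> 0"
      using \<zeta>(1) circle_nonzero by blast
    have pow_left: "\<tau> (x [^] k) y = \<tau> x y powi k" if "y \<in> J" for k :: int and y
      using character_int_pow[OF J bicharacter_left[OF \<tau> that] x] .
    have pow_right: "\<tau> y (x [^] k) = \<tau> y x powi k" if "y \<in> J" for k :: int and y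
      using character_int_pow[OF J bicharacter_right[OF \<tau> that] x] .
    have \<tau>n: "\<tau> x y ^ n = 1" if "y \<in> J" for y
      using character_nat_pow[OF J bicharacter_left[OF \<tau> that] x, of n]
        character_one[OF J bicharacter_left[OF \<tau> that]] xc by (simp add: n_def)
    have e_hom: "g powi e (y \<otimes> z) = g powi e y * g powi e z"
      if "g ^ n = 1" "g \<noteq> 0" "y \<in> J" "z \<in> J" for g :: complex and y z
      using power_int_cong_root_of_unity[OF that(1), of "e (y \<otimes> z)" "e y + e z"] e[OF that(3,4)] that(2)
      by (simp add: n_def power_int_add)
    have \<zeta>kn: "(\<zeta> powi k) ^ n = 1" "\<zeta> powi k \<noteq> 0" for k
    proof -
      have "(\<zeta> powi k) ^ n = \<zeta> powi (int n * k)"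
        by (simp add: mult.commute[of "int n"] power_int_mult)
      then show "(\<zeta> powi k) ^ n = 1"
        using \<zeta>(2) by (simp add: power_int_mult)
      show "\<zeta> powi k \<noteq> 0"
        using \<zeta>0 by simp
    qed
    \<comment> \<open>\<open>y\<close> is \<open>p y\<close> times a power of \<open>x\<close>. The
      \<open>K\<close>-part comes from the induction, the mixed part is loaded entirely onto
      \<open>\<tau> x (p z) powi e y\<close>, its mirror image being supplied by the swapped factor,
      and \<zeta> accounts for \<open>\<tau> x x\<close>. Every base raised to a value of
      \<open>e\<close> is an \<open>n\<close>-th root of unity, so additivity of \<open>e\<close>
      modulo \<open>n\<close> is enough.\<close>
    define \<beta> where
      "\<beta> y z = (\<zeta> powi e z) powi e y * \<tau> x (p z) powi e y * \<beta>K (p y) (p z)" for y z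
    have swap: "(g powi k) powi l = (g powi l) powi k" for g :: complex and k l
      by (simp only: power_int_mult[symmetric] mult.commute)
    have "bicharacter G J \<beta>"
    proof (rule bicharacterI)
      fix y z assume yz: "y \<in> J" "z \<in> J"
      show "\<beta> y z \<in> circle"
        unfolding \<beta>_def using yz x
        by (intro circle_mult circle_power_int \<zeta>(1) bicharacter_circle[OF \<tau>]
            bicharacter_circle[OF \<beta>K] pK pJ) auto
      fix w assume w: "w \<in> J"
      show "\<beta> (y \<otimes> z) w = \<beta> y w * \<beta> z w"
        unfolding \<beta>_def
        by (simp add: e_hom[OF \<zeta>kn yz] e_hom[OF \<tau>n bicharacter_nonzero[OF \<tau>] yz] x w pJ pK
            yz p_mult bicharacter_mult_left[OF \<beta>K])
      show "\<beta> w (y \<otimes> z) = \<beta> w y * \<beta> w z"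
        unfolding \<beta>_def swap[of \<zeta> _ "e w"]
        by (simp add: e_hom[OF \<zeta>kn yz] x w pJ pK yz p_mult bicharacter_mult_right[OF \<beta>K]
            bicharacter_mult_right[OF \<tau>] power_int_mult_distrib)
    qed
    moreover have "\<beta> y z * \<beta> z y powi s = \<tau> y z" if yz: "y \<in> J" "z \<in> J" for y z
    proof -
      have "\<tau> y z = \<tau> (p y \<otimes> x [^] e y) (p z \<otimes> x [^] e z)"
        using p_eq yz by simp
      also have "\<dots> = \<tau> (p y) (p z) * \<tau> (p y) (x [^] e z) * (\<tau> (x [^] e y) (p z)
          * \<tau> (x [^] e y) (x [^] e z))"
        using yz pJ xk by (simp add: bicharacter_mult_left[OF \<tau>] bicharacter_mult_right[OF \<tau>]
            subgroup.m_closed[OF J])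
      also have "\<tau> (x [^] e y) (x [^] e z) = (\<tau> x x powi e y) powi e z"
        by (simp only: pow_left[OF x] pow_right[OF xk])
      also have "\<tau> (x [^] e y) (p z) = \<tau> x (p z) powi e y"
        by (rule pow_left[OF pJ[OF yz(2)]])
      also have "\<tau> (p y) (x [^] e z) = \<tau> (p y) x powi e z"
        by (rule pow_right[OF pJ[OF yz(1)]])
      also have "\<tau> (p y) (p z) = \<beta>K (p y) (p z) * \<beta>K (p z) (p y) powi s"
        by (rule \<beta>K_eq[OF pK[OF yz(1)] pK[OF yz(2)], symmetric])
      also have "\<tau> (p y) x = \<tau> x (p y) powi s"
        by (rule sym[OF x pJ[OF yz(1)]])
      also have "\<tau> x x = \<zeta> * \<zeta> powi s"
        by (rule \<zeta>(3)[symmetric])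
      finally show ?thesis
        unfolding \<beta>_def power_int_mult_distrib swap[of _ _ s] swap[of \<zeta> "e z" "e y"]
        by (simp only: mult_ac)
    qed
    ultimately show ?thesis
      by blast
  qed
qed

text \<open>This is the commutator pairing of the central extension attached to \<psi>; commutators
  with central values are multiplicative in each argument.\<close>

lemma cocycle_alternation:
  assumes J: "subgroup J G" and "cocycle_on G J \<psi>"
  shows "bicharacter G J (\<lambda>a b. \<psi> a b / \<psi> b a)"
proof (rule bicharacterI)
  note Jc = subgroup.mem_carrier[OF J]
  have \<psi>: "\<psi> a b \<in> circle" if "a \<in> J" "b \<in> J" for a b
    using assms(2) that by (auto simp: cocycle_on_def)
  have 0: "\<psi> a b \<noteq> 0" if "a \<in> J" "b \<in> J" for a b
    using \<psi>[OF that] circle_nonzero by blast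
  have eq: "\<psi> b c * \<psi> a (b \<otimes> c) = \<psi> (a \<otimes> b) c * \<psi> a b" if "a \<in> J" "b \<in> J" "c \<in> J" for a b c
    using assms(2) that by (auto simp: cocycle_on_def)
  show "\<psi> a b / \<psi> b a \<in> circle" if "a \<in> J" "b \<in> J" for a b
    using \<psi> that by (simp add: circle_divide)
  have main: "\<psi> (a \<otimes> b) c * \<psi> c a * \<psi> c b = \<psi> c (a \<otimes> b) * \<psi> a c * \<psi> b c"
    if abc: "a \<in> J" "b \<in> J" "c \<in> J" for a b c
  proof -
    have m: "a \<otimes> b \<in> J" "b \<otimes> c \<in> J" "a \<otimes> c \<in> J"
      using subgroup.m_closed[OF J] abc by auto
    have comm: "c \<otimes> a = a \<otimes> c" "c \<otimes> b = b \<otimes> c"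
      using Jc abc m_comm by auto
    define A1 A2 A3 A4 A5 A6 A7 A8 A9 where
      "A1 = \<psi> b c" and "A2 = \<psi> a (b \<otimes> c)" and "A3 = \<psi> (a \<otimes> b) c" and "A4 = \<psi> a b"
      and "A5 = \<psi> c (a \<otimes> b)" and "A6 = \<psi> (a \<otimes> c) b" and "A7 = \<psi> c a" and "A8 = \<psi> c b"
      and "A9 = \<psi> a c"
    \<comment> \<open>The cocycle identity at \<open>(a, b, c)\<close>, \<open>(c, a, b)\<close> and
      \<open>(a, c, b)\<close>, with arguments identified by commutativity. In the product of the
      three, \<open>A2\<close>, \<open>A4\<close> and \<open>A6\<close> occur on both sides and
      cancel.\<close>
    have "A1 * A2 = A3 * A4" "A4 * A5 = A6 * A7" "A8 * A2 = A6 * A9"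
      using eq[of a b c] eq[of c a b] eq[of a c b] abc comm
      by (simp_all add: A1_def A2_def A3_def A4_def A5_def A6_def A7_def A8_def A9_def)
    moreover have "A2 \<noteq> 0" "A4 \<noteq> 0" "A6 \<noteq> 0"
      using 0 abc m by (auto simp: A2_def A4_def A6_def)
    moreover have "(A3 * A7 * A8) * (A4 * A2 * A6) = (A3 * A4) * (A6 * A7) * (A8 * A2)"
      "(A5 * A9 * A1) * (A4 * A2 * A6) = (A1 * A2) * (A4 * A5) * (A6 * A9)"
      by simp_all
    ultimately have "A3 * A7 * A8 = A5 * A9 * A1"
      by (metis mult_cancel_right mult_eq_0_iff)
    then show ?thesis
      by (simp add: A1_def A3_def A5_def A7_def A8_def A9_def)
  qed
  fix a b c assume abc: "a \<in> J" "b \<in> J" "c \<in> J"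
  then have m: "a \<otimes> b \<in> J" "b \<otimes> c \<in> J"
    using subgroup.m_closed[OF J] by auto
  show "\<psi> (a \<otimes> b) c / \<psi> c (a \<otimes> b) = \<psi> a c / \<psi> c a * (\<psi> b c / \<psi> c b)"
    using main[OF abc] 0 abc m by (simp add: field_simps)
  show "\<psi> a (b \<otimes> c) / \<psi> (b \<otimes> c) a = \<psi> a b / \<psi> b a * (\<psi> a c / \<psi> c a)"
    using main[OF abc(2,3,1)] 0 abc m by (simp add: field_simps)
qed

text \<open>Both sides of the cocycle identity expand to
  \<open>\<beta> a b * \<beta> a c * \<beta> b c\<close>. Together with the factorization this
  supplies cocycles with a prescribed alternating quotient.\<close>

lemma bicharacter_cocycle:
  assumes J: "subgroup J G" and "bicharacter G J \<beta>"
  shows "cocycle_on G J \<beta>"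
  using subgroup.m_closed[OF J]
  by (simp add: cocycle_on_def bicharacter_circle[OF assms(2)] bicharacter_mult_left[OF assms(2)]
      bicharacter_mult_right[OF assms(2)])

end

section \<open>Orthogonality relations and nondegenerate pairings on finite abelian groups\<close>

lemma (in group) sum_character_eq_0:
  assumes fin: "finite J" and J: "subgroup J G" and \<eta>: "character G J \<eta>"
    and x: "x \<in> J" "\<eta> x \<noteq> 1"
  shows "(\<Sum>y\<in>J. \<eta> y) = 0"
proof -
  note Jc = subgroup.mem_carrier[OF J]
  have "bij_betw (\<lambda>y. x \<otimes> y) J J"
    using x(1) subgroup.m_closed[OF J] subgroup.m_inv_closed[OF J x(1)] Jc
    by (intro bij_betw_byWitness[where f' = "\<lambda>y. inv x \<otimes> y"]) (auto simp: m_assoc[symmetric])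
  then have "(\<Sum>y\<in>J. \<eta> y) = (\<Sum>y\<in>J. \<eta> (x \<otimes> y))"
    by (rule sum.reindex_bij_betw[symmetric])
  also have "\<dots> = \<eta> x * (\<Sum>y\<in>J. \<eta> y)"
    using x(1) by (simp add: character_mult[OF \<eta>] sum_distrib_left)
  finally show ?thesis
    using x(2) by simp
qed

locale nondegenerate_pairing = comm_group G for G (structure) +
  fixes B
  assumes fin: "finite (carrier G)"
    and pairing: "bicharacter G (carrier G) B"
    and pairing_sym: "\<And>x y. x \<in> carrier G \<Longrightarrow> y \<in> carrier G \<Longrightarrow> B x y = B y x"
    and nondegenerate: "\<And>x. x \<in> carrier G \<Longrightarrow> (\<And>y. y \<in> carrier G \<Longrightarrow> B x y = 1) \<Longrightarrow> x = \<one>"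
begin

lemma pairing_one:
  assumes "x \<in> carrier G"
  shows "B x \<one> = 1" "B \<one> x = 1"
  using character_one[OF subgroup_self bicharacter_right[OF pairing assms]]
    character_one[OF subgroup_self bicharacter_left[OF pairing assms]] by auto

lemma pairing_inv:
  assumes "x \<in> carrier G" "y \<in> carrier G"
  shows "B x (inv y) = inverse (B x y)" "B (inv x) y = inverse (B x y)"
  using character_inv[OF subgroup_self bicharacter_right[OF pairing assms(1)] assms(2)]
    character_inv[OF subgroup_self bicharacter_left[OF pairing assms(2)] assms(1)] by auto

lemmas pairing_mult_left = bicharacter_mult_left[OF pairing]
lemmas pairing_mult_right = bicharacter_mult_right[OF pairing]
lemmas pairing_circle = bicharacter_circle[OF pairing]
lemmas pairing_nonzero = bicharacter_nonzero[OF pairing]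

lemma sum_pairing_eq_0:
  assumes "x \<in> carrier G" "x \<noteq> \<one>"
  shows "(\<Sum>y\<in>carrier G. B y x) = 0"
proof -
  obtain y where "y \<in> carrier G" "B x y \<noteq> 1"
    using nondegenerate assms by blast
  then show ?thesis
    using sum_character_eq_0[OF fin subgroup_self bicharacter_left[OF pairing assms(1)]]
      pairing_sym assms(1) by metis
qed

text \<open>If \<open>\<eta>\<close> differed from every \<open>B g\<close> on \<open>J\<close>, the double sum of \<open>\<eta> x * B g (inv x)\<close> over \<open>g\<close> and
  \<open>x\<close> would vanish termwise in \<open>g\<close>, whereas summing over \<open>g\<close> first gives the order of \<open>G\<close>.\<close>
lemma character_represented:
  assumes J: "subgroup J G" and \<eta>: "character G J \<eta>"
  obtains g where "g \<in> carrier G" "\<And>k. k \<in> J \<Longrightarrow> B g k = \<eta> k"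
proof (rule ccontr)
  assume "\<not> thesis"
  then have contr: "\<exists>k\<in>J. B g k \<noteq> \<eta> k" if "g \<in> carrier G" for g
    using that \<open>\<And>g. \<lbrakk>g \<in> carrier G; \<And>k. k \<in> J \<Longrightarrow> B g k = \<eta> k\<rbrakk> \<Longrightarrow> thesis\<close> by blast
  note Jc = subgroup.mem_carrier[OF J]
  have finJ: "finite J"
    using fin subgroup.subset[OF J] finite_subset by blast
  have one: "\<one> \<in> J"
    using subgroup.one_closed[OF J] .
  have "(\<Sum>x\<in>J. \<eta> x * B g (inv x)) = 0" if g: "g \<in> carrier G" for g
  proof -
    obtain k where k: "k \<in> J" "B g k \<noteq> \<eta> k"
      using contr[OF g] by blast
    have "character G J (\<lambda>x. \<eta> x * B g (inv x))"
      using g Jc by (auto simp: character_def circle_mult character_circle[OF \<eta>] pairing_circle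
          character_mult[OF \<eta>] pairing_mult_right inv_mult)
    moreover have "\<eta> k * B g (inv k) \<noteq> 1"
      using k g Jc pairing_nonzero by (auto simp: pairing_inv field_simps)
    ultimately show ?thesis
      using sum_character_eq_0[OF finJ J _ k(1)] by blast
  qed
  then have "0 = (\<Sum>g\<in>carrier G. \<Sum>x\<in>J. \<eta> x * B g (inv x))"
    by simp
  also have "\<dots> = (\<Sum>x\<in>J. \<eta> x * (\<Sum>g\<in>carrier G. B g (inv x)))"
    by (subst sum.swap) (simp add: sum_distrib_left)
  also have "\<dots> = (\<Sum>x\<in>J. if x = \<one> then of_nat (card (carrier G)) else 0)"
  proof (rule sum.cong)
    fix x assume x: "x \<in> J"
    show "\<eta> x * (\<Sum>g\<in>carrier G. B g (inv x)) = (if x = \<one> then of_nat (card (carrier G)) else 0)"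
    proof (cases "x = \<one>")
      case True
      then show ?thesis
        using character_one[OF J \<eta>] by (simp add: pairing_one)
    next
      case False
      then have "inv x \<noteq> \<one>"
        using Jc[OF x] by (metis inv_inv inv_one)
      then show ?thesis
        using sum_pairing_eq_0[of "inv x"] Jc[OF x] False by simp
    qed
  qed simp
  also have "\<dots> = of_nat (card (carrier G))"
    using finJ one by simp
  finally show False
    using fin one_closed by (auto simp: card_eq_0_iff)
qed

text \<open>The sum of \<open>B y (j \<otimes> inv g)\<close> over \<open>j\<close> in
  \<open>J\<close> and \<open>y\<close> in the group is evaluated in two ways. For \<open>g\<close>
  outside \<open>J\<close> every sum over \<open>y\<close> vanishes, whereas summing over
  \<open>j\<close> first leaves \<open>card J\<close> for each \<open>y\<close> in the annihilator
  \<open>P\<close> of \<open>J\<close>, since \<open>B y g = 1\<close> there.\<close>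

lemma annihilator_annihilator:
  assumes J: "subgroup J G" and g: "g \<in> carrier G"
    and ann: "\<And>y. y \<in> carrier G \<Longrightarrow> (\<And>j. j \<in> J \<Longrightarrow> B y j = 1) \<Longrightarrow> B y g = 1"
  shows "g \<in> J"
proof (rule ccontr)
  assume gJ: "g \<notin> J"
  note Jc = subgroup.mem_carrier[OF J]
  have finJ: "finite J"
    using fin subgroup.subset[OF J] finite_subset by blast
  have one: "\<one> \<in> J"
    using subgroup.one_closed[OF J] .
  define P where "P = {y \<in> carrier G. \<forall>j\<in>J. B y j = 1}"
  have "(\<Sum>y\<in>carrier G. B y (j \<otimes> inv g)) = 0" if j: "j \<in> J" for j
  proof (rule sum_pairing_eq_0)
    show "j \<otimes> inv g \<noteq> \<one>"
      using gJ j Jc[OF j] g by (metis inv_inv inv_closed inv_equality)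
  qed (use Jc j g in simp)
  then have "0 = (\<Sum>j\<in>J. \<Sum>y\<in>carrier G. B y (j \<otimes> inv g))"
    by simp
  also have "\<dots> = (\<Sum>y\<in>carrier G. B y (inv g) * (\<Sum>j\<in>J. B y j))"
    using Jc g by (subst sum.swap) (simp add: sum_distrib_right pairing_mult_right mult.commute)
  also have "\<dots> = (\<Sum>y\<in>carrier G. if y \<in> P then of_nat (card J) else 0)"
  proof (rule sum.cong)
    fix y assume y: "y \<in> carrier G"
    show "B y (inv g) * (\<Sum>j\<in>J. B y j) = (if y \<in> P then of_nat (card J) else 0)"
    proof (cases "y \<in> P")
      case True
      then show ?thesis
        using ann[OF y] g y by (simp add: P_def pairing_inv)
    next
      case False
      then obtain j where "j \<in> J" "B y j \<noteq> 1"
        using y by (auto simp: P_def)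
      then show ?thesis
        using sum_character_eq_0[OF finJ J character_subset[OF bicharacter_right[OF pairing y]
            subgroup.subset[OF J]]] False by simp
    qed
  qed simp
  also have "\<dots> = of_nat (card P * card J)"
    using fin by (simp add: P_def sum.If_cases Int_def)
  finally have "card P * card J = 0"
    by (metis of_nat_eq_0_iff)
  moreover have "\<one> \<in> P" "finite P"
    using fin Jc by (auto simp: P_def pairing_one)
  ultimately show False
    using one finJ by auto
qed

end

section \<open>Self-orthogonal subgroups and polarizations\<close>

lemma cord_dvd:
  assumes "z ^ n = 1" "0 < n"
  shows "0 < cord z" "z ^ k = 1 \<longleftrightarrow> cord z dvd k"
proof -
  define P where "P n \<longleftrightarrow> 0 < n \<and> z ^ n = 1" for n :: nat
  have ex: "\<exists>n. P n"
    using assms unfolding P_def by blast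
  then have cord: "cord z = (LEAST n. P n)"
    unfolding cord_def P_def by (rule if_P)
  have "P (cord z)"
    unfolding cord using ex by (rule LeastI_ex)
  then have c: "0 < cord z" "z ^ cord z = 1"
    by (auto simp: P_def)
  show "0 < cord z"
    by (rule c)
  show "z ^ k = 1 \<longleftrightarrow> cord z dvd k"
  proof
    assume "cord z dvd k"
    then show "z ^ k = 1"
      using c(2) by (metis dvd_def power_mult power_one)
  next
    assume k: "z ^ k = 1"
    have "z ^ k = z ^ (cord z * (k div cord z)) * z ^ (k mod cord z)"
      by (metis mult_div_mod_eq power_add)
    then have "z ^ (k mod cord z) = 1"
      by (simp only: k power_mult c(2) power_one mult_1)
    moreover have "\<not> P (k mod cord z)"
      using not_less_Least[of "k mod cord z" P] c(1) by (simp flip: cord)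
    ultimately have "k mod cord z = 0"
      by (simp add: P_def)
    then show "cord z dvd k"
      by (simp add: dvd_eq_mod_eq_0)
  qed
qed

lemma (in comm_group) mult_inv_mult_inv:
  "a \<in> carrier G \<Longrightarrow> b \<in> carrier G \<Longrightarrow> a \<otimes> inv (a \<otimes> inv b) = b"
  by (simp add: inv_mult m_assoc[symmetric])

context nondegenerate_pairing
begin

text \<open>Over each difference \<open>j\<close> this collects the pairs whose first component
  represents the character \<open>\<beta> j\<close> on \<open>J\<close>. The name anticipates that,
  when \<beta> is a polarization, the set is its own orthogonal.\<close>

definition lagrangian :: "'a set \<Rightarrow> ('a \<Rightarrow> 'a \<Rightarrow> complex) \<Rightarrow> ('a \<times> 'a) set" where
  "lagrangian J \<beta> = {(g, h). g \<in> carrier G \<and> h \<in> carrier G \<and> g \<otimes> inv h \<in> J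
     \<and> (\<forall>k\<in>J. B g k = \<beta> (g \<otimes> inv h) k)}"

text \<open>The equation \<open>B g g' = B h h'\<close> says that \<open>pair2\<close> is 1, because
  conjugation inverts elements of the circle.\<close>

definition orthogonal :: "('a \<times> 'a) set \<Rightarrow> ('a \<times> 'a) set" where
  "orthogonal Z = {(g, h). g \<in> carrier G \<and> h \<in> carrier G \<and> (\<forall>(g', h')\<in>Z. B g g' = B h h')}"

definition subgroup2 :: "('a \<times> 'a) set \<Rightarrow> bool" where
  "subgroup2 Z \<longleftrightarrow> Z \<subseteq> carrier G \<times> carrier G \<and> (\<one>, \<one>) \<in> Z
     \<and> (\<forall>(g, h)\<in>Z. \<forall>(g', h')\<in>Z. (g \<otimes> g', h \<otimes> h') \<in> Z) \<and> (\<forall>(g, h)\<in>Z. (inv g, inv h) \<in> Z)"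

text \<open>A half of \<open>B\<close> that may be asymmetric, which lets it exist in cases where
  division by two fails.\<close>

definition polarization :: "'a set \<Rightarrow> ('a \<Rightarrow> 'a \<Rightarrow> complex) \<Rightarrow> bool" where
  "polarization J \<beta> \<longleftrightarrow> bicharacter G J \<beta> \<and> (\<forall>x\<in>J. \<forall>y\<in>J. \<beta> x y * \<beta> y x = B x y)"

lemma polarizationD:
  assumes "polarization J \<beta>"
  shows "bicharacter G J \<beta>" "\<And>x y. x \<in> J \<Longrightarrow> y \<in> J \<Longrightarrow> \<beta> x y * \<beta> y x = B x y"
  using assms by (auto simp: polarization_def)

lemma lagrangian_subgroup:
  assumes J: "subgroup J G" and \<beta>: "bicharacter G J \<beta>"
  shows "subgroup2 (lagrangian J \<beta>)"
  unfolding subgroup2_def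
proof (intro conjI)
  note Jc = subgroup.mem_carrier[OF J]
  show "lagrangian J \<beta> \<subseteq> carrier G \<times> carrier G"
    by (auto simp: lagrangian_def)
  show "(\<one>, \<one>) \<in> lagrangian J \<beta>"
    using subgroup.one_closed[OF J] Jc character_one[OF J bicharacter_left[OF \<beta>]]
    by (auto simp: lagrangian_def pairing_one)
  have "(g \<otimes> g', h \<otimes> h') \<in> lagrangian J \<beta>"
    if "(g, h) \<in> lagrangian J \<beta>" "(g', h') \<in> lagrangian J \<beta>" for g h g' h'
  proof -
    have c: "g \<in> carrier G" "h \<in> carrier G" "g' \<in> carrier G" "h' \<in> carrier G"
      and j: "g \<otimes> inv h \<in> J" "g' \<otimes> inv h' \<in> J"
      using that by (auto simp: lagrangian_def)
    have eq: "(g \<otimes> g') \<otimes> inv (h \<otimes> h') = (g \<otimes> inv h) \<otimes> (g' \<otimes> inv h')"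
      using c by (simp add: inv_mult m_ac)
    show ?thesis
      using that c subgroup.m_closed[OF J j] unfolding lagrangian_def
      by (auto simp: eq pairing_mult_left Jc bicharacter_mult_left[OF \<beta> j])
  qed
  then show "\<forall>(g, h)\<in>lagrangian J \<beta>. \<forall>(g', h')\<in>lagrangian J \<beta>. (g \<otimes> g', h \<otimes> h') \<in> lagrangian J \<beta>"
    by blast
  have "(inv g, inv h) \<in> lagrangian J \<beta>" if "(g, h) \<in> lagrangian J \<beta>" for g h
  proof -
    have c: "g \<in> carrier G" "h \<in> carrier G" and j: "g \<otimes> inv h \<in> J"
      using that by (auto simp: lagrangian_def)
    have eq: "inv g \<otimes> inv (inv h) = inv (g \<otimes> inv h)"
      using c by (simp add: inv_mult)
    show ?thesis
      using that c subgroup.m_inv_closed[OF J j] unfolding lagrangian_def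
      by (auto simp only: eq pairing_inv Jc character_inv[OF J bicharacter_left[OF \<beta>] j] mem_Collect_eq
          case_prod_conv inv_closed)
  qed
  then show "\<forall>(g, h)\<in>lagrangian J \<beta>. (inv g, inv h) \<in> lagrangian J \<beta>"
    by blast
qed

text \<open>The fibre over \<open>j\<close> is nonempty because the character
  \<open>\<beta> j\<close> of \<open>J\<close> is represented by a group element.\<close>

lemma lagrangian_element:
  assumes J: "subgroup J G" and \<beta>: "bicharacter G J \<beta>" and j: "j \<in> J"
  obtains g where "g \<in> carrier G" "(g, g \<otimes> inv j) \<in> lagrangian J \<beta>" "g \<otimes> inv (g \<otimes> inv j) = j"
    "\<And>k. k \<in> J \<Longrightarrow> B g k = \<beta> j k"
proof -
  obtain g where g: "g \<in> carrier G" "\<And>k. k \<in> J \<Longrightarrow> B g k = \<beta> j k"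
    using character_represented[OF J bicharacter_right[OF \<beta> j]] by blast
  have jc: "j \<in> carrier G"
    using subgroup.mem_carrier[OF J j] .
  have "g \<otimes> inv (g \<otimes> inv j) = j"
    using g(1) jc by (rule mult_inv_mult_inv)
  then show thesis
    using that g jc j by (simp add: lagrangian_def)
qed

text \<open>Isotropy is the polarization identity read through \<open>split\<close>. For the
  converse, an orthogonal pair is tested against the diagonal pairs \<open>(y, y)\<close> with
  \<open>y\<close> annihilating \<open>J\<close>, which puts its difference into the double
  annihilator of \<open>J\<close>, and then against one pair over each \<open>k\<close> in
  \<open>J\<close>, which determines \<open>B g k\<close>.\<close>

lemma orthogonal_lagrangian:
  assumes J: "subgroup J G" and "polarization J \<beta>"
  shows "orthogonal (lagrangian J \<beta>) = lagrangian J \<beta>"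
proof (intro equalityI subrelI)
  note \<beta> = polarizationD(1)[OF assms(2)] and pol = polarizationD(2)[OF assms(2)]
  note Jc = subgroup.mem_carrier[OF J]
  have split: "B g g' * B (g \<otimes> inv h) (g' \<otimes> inv h')
      = B h h' * (B g (g' \<otimes> inv h') * B g' (g \<otimes> inv h))"
    if "g \<in> carrier G" "h \<in> carrier G" "g' \<in> carrier G" "h' \<in> carrier G" for g h g' h'
    using that pairing_sym[of g' g] pairing_sym[of g' h] pairing_nonzero
    by (simp add: pairing_mult_left pairing_mult_right pairing_inv field_simps)
  fix g h
  {
    assume gh: "(g, h) \<in> lagrangian J \<beta>"
    have "B g g' = B h h'" if g'h': "(g', h') \<in> lagrangian J \<beta>" for g' h'
    proof -
      define j j' where "j = g \<otimes> inv h" and "j' = g' \<otimes> inv h'"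
      have c: "g \<in> carrier G" "h \<in> carrier G" "g' \<in> carrier G" "h' \<in> carrier G"
        and j: "j \<in> J" "j' \<in> J" and eq: "B g j' = \<beta> j j'" "B g' j = \<beta> j' j"
        using gh g'h' by (auto simp: lagrangian_def j_def j'_def)
      have "B g g' * B j j' = B h h' * B j j'"
        using split[OF c] unfolding j_def[symmetric] j'_def[symmetric] eq pol[OF j] .
      then show ?thesis
        using pairing_nonzero j Jc by simp
    qed
    then show "(g, h) \<in> orthogonal (lagrangian J \<beta>)"
      using gh by (auto simp: orthogonal_def lagrangian_def)
  next
    assume gh: "(g, h) \<in> orthogonal (lagrangian J \<beta>)"
    then have c: "g \<in> carrier G" "h \<in> carrier G"
      and orth: "\<And>g' h'. (g', h') \<in> lagrangian J \<beta> \<Longrightarrow> B g g' = B h h'"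
      by (auto simp: orthogonal_def)
    define j where "j = g \<otimes> inv h"
    have jc: "j \<in> carrier G"
      using c by (simp add: j_def)
    have "j \<in> J"
    proof (rule annihilator_annihilator[OF J jc])
      fix y assume y: "y \<in> carrier G" "\<And>k. k \<in> J \<Longrightarrow> B y k = 1"
      have "(y, y) \<in> lagrangian J \<beta>"
        using y subgroup.one_closed[OF J] character_one[OF J bicharacter_left[OF \<beta>]]
        by (auto simp: lagrangian_def)
      then have "B g y = B h y"
        by (rule orth)
      then show "B y j = 1"
        using c y(1) pairing_nonzero pairing_sym
        by (simp add: j_def pairing_mult_right pairing_inv)
    qed
    moreover have "B g k = \<beta> j k" if k: "k \<in> J" for k
    proof -
      obtain g' where g': "g' \<in> carrier G" "(g', g' \<otimes> inv k) \<in> lagrangian J \<beta>"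
        "g' \<otimes> inv (g' \<otimes> inv k) = k" and B_g': "\<And>l. l \<in> J \<Longrightarrow> B g' l = \<beta> k l"
        using lagrangian_element[OF J \<beta> k] by metis
      define h' where "h' = g' \<otimes> inv k"
      have h': "h' \<in> carrier G" "B g g' = B h h'" "g' \<otimes> inv h' = k"
        using g' k Jc orth by (auto simp: h'_def)
      have "B h h' * B j k = B h h' * (B g k * \<beta> k j)"
        using split[OF c g'(1) h'(1)] B_g'[OF \<open>j \<in> J\<close>] unfolding h'(2,3) j_def by simp
      then have "\<beta> j k * \<beta> k j = B g k * \<beta> k j"
        using pairing_nonzero c h' pol[OF \<open>j \<in> J\<close> k] by simp
      then show ?thesis
        using bicharacter_nonzero[OF \<beta> k \<open>j \<in> J\<close>] by simp
    qed
    ultimately show "(g, h) \<in> lagrangian J \<beta>"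
      using c by (simp add: lagrangian_def j_def)
  }
qed

text \<open>\<open>J\<close> is recovered as the set of differences, and \<open>\<beta> x\<close> as
  the restriction of \<open>B g\<close> to \<open>J\<close> for a pair with first component
  \<open>g\<close> and difference \<open>x\<close>.\<close>

lemma lagrangian_le:
  assumes J: "subgroup J G" and \<beta>: "bicharacter G J \<beta>"
    and eq: "lagrangian J \<beta> = lagrangian J' \<beta>'"
  shows "J \<subseteq> J'" "\<And>x y. x \<in> J \<Longrightarrow> y \<in> J \<Longrightarrow> \<beta> x y = \<beta>' x y"
proof -
  have *: "x \<in> J'" "y \<in> J \<Longrightarrow> y \<in> J' \<Longrightarrow> \<beta> x y = \<beta>' x y" if x: "x \<in> J" for x y
  proof -
    obtain g where g: "g \<in> carrier G" "(g, g \<otimes> inv x) \<in> lagrangian J \<beta>"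
      "g \<otimes> inv (g \<otimes> inv x) = x" "\<And>k. k \<in> J \<Longrightarrow> B g k = \<beta> x k"
      using lagrangian_element[OF J \<beta> x] by metis
    have "(g, g \<otimes> inv x) \<in> lagrangian J' \<beta>'"
      using g(2) eq by simp
    then have x': "x \<in> J'" and g': "\<And>k. k \<in> J' \<Longrightarrow> B g k = \<beta>' x k"
      using g(3) by (auto simp: lagrangian_def)
    show "x \<in> J'"
      by (rule x')
    show "\<beta> x y = \<beta>' x y" if "y \<in> J" "y \<in> J'"
      using g(4)[OF that(1)] g'[OF that(2)] by simp
  qed
  then show "J \<subseteq> J'" "\<And>x y. x \<in> J \<Longrightarrow> y \<in> J \<Longrightarrow> \<beta> x y = \<beta>' x y"
    by auto
qed

lemma lagrangian_inject:
  assumes "subgroup J G" "bicharacter G J \<beta>" "subgroup J' G" "bicharacter G J' \<beta>'"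
    and "lagrangian J \<beta> = lagrangian J' \<beta>'"
  shows "J = J'" "\<And>x y. x \<in> J \<Longrightarrow> y \<in> J \<Longrightarrow> \<beta> x y = \<beta>' x y"
proof -
  show "J = J'"
    using lagrangian_le(1)[OF assms(1,2,5)] lagrangian_le(1)[OF assms(3,4) assms(5)[symmetric]]
    by (rule equalityI)
qed (rule lagrangian_le(2)[OF assms(1,2,5)])

lemma lagrangian_exists:
  assumes Z: "subgroup2 Z" and perp: "orthogonal Z = Z"
  obtains J \<beta> where "subgroup J G" "polarization J \<beta>" "Z = lagrangian J \<beta>"
proof -
  have Zc: "g \<in> carrier G" "h \<in> carrier G" if "(g, h) \<in> Z" for g h
    using Z that by (auto simp: subgroup2_def)
  have Z1: "(\<one>, \<one>) \<in> Z"
    using Z by (simp add: subgroup2_def)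
  have Zm: "(g \<otimes> g', h \<otimes> h') \<in> Z" if "(g, h) \<in> Z" "(g', h') \<in> Z" for g h g' h'
    using Z that unfolding subgroup2_def by blast
  have Zi: "(inv g, inv h) \<in> Z" if "(g, h) \<in> Z" for g h
    using Z that unfolding subgroup2_def by blast
  have iso: "B g g' = B h h'" if "(g, h) \<in> Z" "(g', h') \<in> Z" for g h g' h'
    using that perp unfolding orthogonal_def by blast
  define J where "J = {g \<otimes> inv h | g h. (g, h) \<in> Z}"
  have JI: "g \<otimes> inv h \<in> J" if "(g, h) \<in> Z" for g h
    using that by (auto simp: J_def)
  have J: "subgroup J G"
  proof (rule subgroupI)
    show "J \<subseteq> carrier G"
      using Zc by (auto simp: J_def)
    show "J \<noteq> {}"
      using Z1 by (auto simp: J_def)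
    fix a assume "a \<in> J"
    then obtain g h where gh: "(g, h) \<in> Z" "a = g \<otimes> inv h"
      by (auto simp: J_def)
    then have "inv a = inv g \<otimes> inv (inv h)"
      using Zc by (simp add: inv_mult)
    then show "inv a \<in> J"
      using Zi[OF gh(1)] JI by metis
    fix b assume "b \<in> J"
    then obtain g' h' where gh': "(g', h') \<in> Z" "b = g' \<otimes> inv h'"
      by (auto simp: J_def)
    then have "a \<otimes> b = (g \<otimes> g') \<otimes> inv (h \<otimes> h')"
      using gh Zc[OF gh(1)] Zc[OF gh'(1)] by (simp add: inv_mult m_ac)
    then show "a \<otimes> b \<in> J"
      using Zm[OF gh(1) gh'(1)] JI by metis
  qed
  note Jc = subgroup.mem_carrier[OF J]
  have "\<exists>g. (g, g \<otimes> inv j) \<in> Z" if "j \<in> J" for j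
  proof -
    obtain g h where gh: "(g, h) \<in> Z" "j = g \<otimes> inv h"
      using \<open>j \<in> J\<close> by (auto simp: J_def)
    have "g \<otimes> inv j = h"
      using Zc[OF gh(1)] by (simp add: gh(2) mult_inv_mult_inv)
    then show ?thesis
      using gh(1) by metis
  qed
  then obtain r where r: "\<And>j. j \<in> J \<Longrightarrow> (r j, r j \<otimes> inv j) \<in> Z"
    by metis
  define \<beta> where "\<beta> j k = B (r j) k" for j k
  have rc: "r j \<in> carrier G" if "j \<in> J" for j
    using Zc r that by blast
  have key: "B g k = \<beta> (g \<otimes> inv h) k" if gh: "(g, h) \<in> Z" and k: "k \<in> J" for g h k
  proof -
    define j where "j = g \<otimes> inv h"
    have j: "j \<in> J"
      using JI gh by (simp add: j_def)
    \<comment> \<open>\<open>y\<close> measures how far \<open>(g, h)\<close> is from the chosen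
      pair with the same difference \<open>j\<close>. The quotient of the two pairs is
      \<open>(y, y)\<close>, and its orthogonality to a pair over \<open>k\<close> gives
      \<open>B y k = 1\<close>; hence \<beta> does not depend on the choice of
      \<open>r\<close>.\<close>
    define y where "y = g \<otimes> inv (r j)"
    have c: "g \<in> carrier G" "h \<in> carrier G" "r j \<in> carrier G" "y \<in> carrier G" "k \<in> carrier G"
      using Zc[OF gh] rc[OF j] Jc[OF k] by (auto simp: y_def)
    have "h \<otimes> inv (r j \<otimes> inv j) = (h \<otimes> j) \<otimes> inv (r j)"
      using c Jc[OF j] by (simp add: inv_mult m_ac)
    also have "h \<otimes> j = g"
      using c by (simp add: j_def m_lcomm)
    finally have "h \<otimes> inv (r j \<otimes> inv j) = y"
      by (simp add: y_def)
    then have y: "(y, y) \<in> Z"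
      using Zm[OF gh Zi[OF r[OF j]]] by (simp add: y_def)
    obtain g' h' where k': "(g', h') \<in> Z" "k = g' \<otimes> inv h'"
      using k by (auto simp: J_def)
    have "B y k = 1"
      using iso[OF y k'(1)] Zc[OF k'(1)] c pairing_nonzero
      by (simp add: k'(2) pairing_mult_right pairing_inv)
    then show ?thesis
      using c pairing_nonzero
      by (simp add: y_def pairing_mult_left pairing_inv \<beta>_def flip: j_def)
        (simp add: field_simps)
  qed
  have \<beta>: "bicharacter G J \<beta>"
  proof (rule bicharacterI)
    fix x y z assume xyz: "x \<in> J" "y \<in> J" "z \<in> J"
    show "\<beta> x y \<in> circle"
      using xyz rc Jc by (simp add: \<beta>_def pairing_circle)
    show "\<beta> x (y \<otimes> z) = \<beta> x y * \<beta> x z"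
      using xyz rc Jc by (simp add: \<beta>_def pairing_mult_right)
    have c: "r x \<in> carrier G" "r y \<in> carrier G" "x \<in> carrier G" "y \<in> carrier G" "z \<in> carrier G"
      using xyz rc Jc by auto
    \<comment> \<open>The product of the chosen pairs over \<open>x\<close> and \<open>y\<close>
      lies over \<open>x \<otimes> y\<close> but need not be the chosen one there;
      \<open>key\<close> bridges the gap.\<close>
    have "(r x \<otimes> r y) \<otimes> inv ((r x \<otimes> inv x) \<otimes> (r y \<otimes> inv y)) = x \<otimes> y"
    proof -
      have "(r x \<otimes> inv x) \<otimes> (r y \<otimes> inv y) = (r x \<otimes> r y) \<otimes> inv (x \<otimes> y)"
        using c by (simp add: inv_mult m_ac)
      then show ?thesis
        using c by (simp add: mult_inv_mult_inv)
    qed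
    then have "\<beta> (x \<otimes> y) z = B (r x \<otimes> r y) z"
      using key[OF Zm[OF r r] xyz(3), of x y] xyz by simp
    then show "\<beta> (x \<otimes> y) z = \<beta> x z * \<beta> y z"
      using c by (simp add: \<beta>_def pairing_mult_left)
  qed
  have "\<beta> x y * \<beta> y x = B x y" if xy: "x \<in> J" "y \<in> J" for x y
  proof -
    have c: "r x \<in> carrier G" "r y \<in> carrier G" "x \<in> carrier G" "y \<in> carrier G"
      using xy rc Jc by auto
    have "B (r x) (r y) = B (r x \<otimes> inv x) (r y \<otimes> inv y)"
      using iso r xy by blast
    then show ?thesis
      using c pairing_sym[of x "r y"] pairing_nonzero
      by (simp add: \<beta>_def pairing_mult_left pairing_mult_right pairing_inv field_simps)
  qed
  with \<beta> have pol: "polarization J \<beta>"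
    by (simp add: polarization_def)
  have sub: "Z \<subseteq> lagrangian J \<beta>"
    using key JI Zc by (auto simp: lagrangian_def)
  \<comment> \<open>Taking orthogonals reverses inclusions, and both sets are their own orthogonals,
    so one inclusion gives the other.\<close>
  then have "orthogonal (lagrangian J \<beta>) \<subseteq> orthogonal Z"
    by (auto simp: orthogonal_def)
  then have "lagrangian J \<beta> \<subseteq> Z"
    using perp orthogonal_lagrangian[OF J pol] by simp
  then show thesis
    using that J pol sub by blast
qed

section \<open>Quaternionic elements as the obstruction to a polarization\<close>

definition quaternion_element :: "'a \<Rightarrow> bool" where
  "quaternion_element j \<longleftrightarrow> cord (B j j) = ord j \<and> even (ord j)"

lemma pairing_pow_ord:
  assumes "x \<in> carrier G"
  shows "B x x ^ ord x = 1"
  using character_nat_pow[OF subgroup_self bicharacter_right[OF pairing assms] assms, of "ord x"]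
    assms by (simp add: pairing_one)

text \<open>\<open>B j j\<close> is the square of \<open>\<beta> j j\<close>, whose power with
  exponent \<open>ord j\<close> is 1. If \<open>ord j\<close> is even, its half already annihilates
  \<open>B j j\<close>, which therefore cannot have order \<open>ord j\<close>.\<close>

lemma polarization_no_quaternion:
  assumes J: "subgroup J G" and "polarization J \<beta>" and j: "j \<in> J"
  shows "\<not> quaternion_element j"
proof
  note \<beta> = polarizationD(1)[OF assms(2)] and pol = polarizationD(2)[OF assms(2)]
  assume q: "quaternion_element j"
  have jc: "j \<in> carrier G"
    using subgroup.mem_carrier[OF J j] .
  define m where "m = ord j div 2"
  have m: "ord j = 2 * m"
    using q by (simp add: m_def quaternion_element_def)
  have pos: "0 < ord j"
    using ord_ge_1[OF fin jc] by linarith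
  have "\<beta> j j ^ ord j = \<beta> j (j [^] ord j)"
    by (rule character_nat_pow[OF J bicharacter_right[OF \<beta> j] j, symmetric])
  also have "\<dots> = 1"
    by (simp only: pow_ord_eq_1[OF jc] character_one[OF J bicharacter_right[OF \<beta> j]])
  finally have "\<beta> j j ^ ord j = 1" .
  then have "(\<beta> j j)\<^sup>2 ^ m = 1"
    by (simp only: m power_mult)
  then have "B j j ^ m = 1"
    by (simp only: power2_eq_square pol[OF j j])
  then have "ord j dvd m"
    using cord_dvd(2)[OF pairing_pow_ord[OF jc] pos] q by (simp add: quaternion_element_def)
  then show False
    using dvd_imp_le[of "ord j" m] m pos by linarith
qed

text \<open>For even order \<open>n = 2 ^ a * m\<close> with \<open>m\<close> odd, non-quaternionicity of \<open>x [^] m\<close> forces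
  \<open>B x x ^ (n div 2) = 1\<close>, so that \<open>B x x\<close> is the square of an \<open>n\<close>-th root of unity.\<close>
lemma no_quaternion_square_root:
  assumes J: "subgroup J G" and nq: "\<And>j. j \<in> J \<Longrightarrow> \<not> quaternion_element j" and x: "x \<in> J"
  shows "\<exists>\<zeta>\<in>circle. \<zeta> ^ ord x = 1 \<and> \<zeta> * \<zeta> = B x x"
proof -
  have xc: "x \<in> carrier G"
    using subgroup.mem_carrier[OF J x] .
  define n z where "n = ord x" and "z = B x x"
  have n: "0 < n"
    using ord_ge_1[OF fin xc] by (simp add: n_def)
  have zn: "z ^ n = 1" and z: "z \<in> circle"
    using pairing_pow_ord[OF xc] pairing_circle xc by (auto simp: n_def z_def)
  have "\<exists>\<zeta>\<in>circle. \<zeta> ^ n = 1 \<and> \<zeta> * \<zeta> = z"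
  proof (cases "even n")
    case False
    \<comment> \<open>For odd \<open>n\<close> the number \<open>(n + 1) div 2\<close> is an inverse
      of 2 modulo \<open>n\<close>.\<close>
    then have "(n + 1) div 2 + (n + 1) div 2 = n + 1"
      by presburger
    then have "(z ^ ((n + 1) div 2)) * (z ^ ((n + 1) div 2)) = z ^ (n + 1)"
      by (metis power_add)
    moreover have "(z ^ ((n + 1) div 2)) ^ n = 1"
      using zn by (metis mult.commute power_mult power_one)
    ultimately show ?thesis
      using z zn by (intro bexI[of _ "z ^ ((n + 1) div 2)"]) (auto intro: circle_power)
  next
    case True
    define a where "a = multiplicity 2 n"
    obtain m where m: "n = 2 ^ a * m" "odd m"
      using multiplicity_decompose'[of n 2] n unfolding a_def by auto
    have a: "0 < a"
      using True m by (auto intro!: Nat.gr0I)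
    define j where "j = x [^] m"
    have "m dvd ord x" "m \<noteq> 0"
      using m n by (auto simp flip: n_def)
    then have ord_j: "ord j = 2 ^ a"
      unfolding j_def using ord_pow[OF xc] m n by (simp add: n_def[symmetric])
    have jJ: "j \<in> J"
      unfolding j_def by (metis int_pow_int subgroup_int_pow_closed[OF J x])
    have jc: "j \<in> carrier G"
      using xc by (simp add: j_def)
    have B_j: "B j j = (z ^ m) ^ m"
      using character_nat_pow[OF subgroup_self bicharacter_right[OF pairing jc] xc, of m]
        character_nat_pow[OF subgroup_self bicharacter_left[OF pairing xc] xc, of m]
      by (simp add: z_def j_def)
    note cord_j = cord_dvd[OF pairing_pow_ord[OF jc]]
    have "cord (B j j) dvd 2 ^ a"
      using cord_j(2)[of "2 ^ a"] pairing_pow_ord[OF jc] by (simp add: ord_j)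
    then obtain i where i: "i \<le> a" "cord (B j j) = 2 ^ i"
      by (auto simp: divides_primepow_nat)
    have "i \<noteq> a"
      using nq[OF jJ] i a by (auto simp: quaternion_element_def ord_j)
    then have "cord (B j j) dvd 2 ^ (a - 1)"
      using i by (simp add: le_imp_power_dvd)
    then have "((z ^ m) ^ m) ^ 2 ^ (a - 1) = 1"
      using cord_j(2) by (simp add: ord_j B_j)
    \<comment> \<open>\<open>y\<close> is 1 or -1 because \<open>z ^ n = 1\<close>; since
      \<open>m\<close> is odd, \<open>y ^ m = 1\<close> then leaves only
      \<open>y = 1\<close>.\<close>
    moreover define y where "y = z ^ (n div 2)"
    have n2: "n div 2 = m * 2 ^ (a - 1)"
      using m a by (cases a) auto
    ultimately have "y ^ m = 1"
      by (simp add: y_def power_mult[symmetric] mult_ac)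
    moreover have "y ^ 2 = 1"
      using zn True by (simp add: y_def flip: power_mult)
    moreover obtain i where "m = 2 * i + 1"
      using \<open>odd m\<close> by (rule oddE)
    ultimately have "y = 1"
      by (simp add: power_mult)
    obtain \<omega> where \<omega>: "\<omega> \<in> circle" "\<And>k::int. \<omega> powi k = 1 \<longleftrightarrow> int n dvd k"
      "\<And>z. z ^ n = 1 \<Longrightarrow> \<exists>k::int. z = \<omega> powi k"
      using primitive_root_exists[OF n] by metis
    obtain k where k: "z = \<omega> powi k"
      using \<omega>(3)[OF zn] by blast
    \<comment> \<open>On logarithms, \<open>y = 1\<close> says that \<open>n\<close> divides
      \<open>k * (n div 2)\<close>. So \<open>k\<close> is even, and halving it gives the square
      root.\<close>
    have "\<omega> powi (k * int (n div 2)) = 1"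
      using \<open>y = 1\<close> unfolding y_def k by (simp add: power_int_mult)
    then have "int n dvd k * int (n div 2)"
      using \<omega>(2) by blast
    moreover have "int n = 2 * int (n div 2)" "int (n div 2) \<noteq> 0"
      using True n by auto
    ultimately have "even k"
      using dvd_mult_cancel_right[of 2 "int (n div 2)" k] by simp
    then obtain l where l: "k = l + l"
      by (metis evenE mult_2)
    have "(\<omega> powi l) ^ n = \<omega> powi (int n * l)"
      by (simp add: mult.commute[of "int n"] power_int_mult)
    also have "\<dots> = (\<omega> powi int n) powi l"
      by (rule power_int_mult)
    finally have "(\<omega> powi l) ^ n = 1"
      using \<omega>(2)[of "int n"] by simp
    moreover have "\<omega> powi l * \<omega> powi l = z"
      using circle_nonzero[OF \<omega>(1)] unfolding k l by (subst power_int_add) auto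
    ultimately show ?thesis
      using \<omega>(1) circle_power_int by blast
  qed
  then show ?thesis
    by (simp add: n_def z_def)
qed

lemma polarization_exists:
  assumes J: "subgroup J G" and nq: "\<And>j. j \<in> J \<Longrightarrow> \<not> quaternion_element j"
  shows "\<exists>\<beta>. polarization J \<beta>"
proof -
  have "\<exists>\<beta>. bicharacter G J \<beta> \<and> (\<forall>x\<in>J. \<forall>y\<in>J. \<beta> x y * \<beta> y x powi 1 = B x y)"
  proof (rule bicharacter_factorization[OF fin J])
    show "bicharacter G J B"
      using pairing subgroup.subset[OF J] by (rule bicharacter_subset)
    show "B y x = B x y powi 1" if "x \<in> J" "y \<in> J" for x y
      using pairing_sym[of y x] subgroup.mem_carrier[OF J] that by simp
    show "\<exists>\<zeta>\<in>circle. \<zeta> ^ ord x = 1 \<and> \<zeta> * \<zeta> powi 1 = B x x" if "x \<in> J" for x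
      using no_quaternion_square_root[OF J nq that] by simp
  qed simp
  then show ?thesis
    by (simp add: polarization_def)
qed

end

section \<open>The discriminant group of an integral lattice\<close>

definition discriminant_group :: "(real^'n) set \<Rightarrow> (real^'n) set monoid" where
  "discriminant_group L = \<lparr>carrier = disc L, monoid.mult = gadd, one = L\<rparr>"

lemma carrier_discriminant_group [simp]: "carrier (discriminant_group L) = disc L"
  and mult_discriminant_group [simp]: "x \<otimes>\<^bsub>discriminant_group L\<^esub> y = gadd x y"
  and one_discriminant_group [simp]: "\<one>\<^bsub>discriminant_group L\<^esub> = L"
  by (simp_all add: discriminant_group_def)

lemma cis_2pi_eq_1_iff: "cis (- 2 * pi * t) = 1 \<longleftrightarrow> t \<in> \<int>"
proof
  assume "cis (- 2 * pi * t) = 1"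
  then have "cos (- 2 * pi * t) = 1"
    by (metis cis.sel(1) one_complex.sel(1))
  then obtain n :: int where n: "- 2 * pi * t = of_int n * 2 * pi"
    unfolding cos_one_2pi_int by blast
  then have "pi * (- t) = pi * of_int n"
    by simp
  then have "- t = of_int n"
    by (simp only: mult_cancel_left pi_neq_zero simp_thms)
  then show "t \<in> \<int>"
    by (metis Ints_minus Ints_of_int minus_minus)
next
  assume "t \<in> \<int>"
  then have "cis (2 * pi * (- t)) = 1"
    by (intro cis_multiple_2pi) simp
  then show "cis (- 2 * pi * t) = 1"
    by simp
qed

lemma cis_2pi_cong: "t - s \<in> \<int> \<Longrightarrow> cis (- 2 * pi * t) = cis (- 2 * pi * s)"
  using cis_2pi_eq_1_iff[of "t - s"] cis_mult[of "- 2 * pi * (t - s)" "- 2 * pi * s"]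
  by (simp add: algebra_simps)

lemma pair_cis: "pair X Y = cis (- 2 * pi * (rep X \<bullet> rep Y))"
  by (simp add: pair_def cis_conv_exp mult_ac)

locale integral_lattice =
  fixes L :: "(real^'n) set"
  assumes zero_mem: "0 \<in> L"
    and add_mem: "u \<in> L \<Longrightarrow> v \<in> L \<Longrightarrow> u + v \<in> L"
    and neg_mem: "u \<in> L \<Longrightarrow> - u \<in> L"
    and integral: "u \<in> L \<Longrightarrow> v \<in> L \<Longrightarrow> u \<bullet> v \<in> \<int>"
begin

lemma diff_mem: "u \<in> L \<Longrightarrow> v \<in> L \<Longrightarrow> u - v \<in> L"
  using add_mem neg_mem by (metis diff_conv_add_uminus)

lemma dual_zero: "0 \<in> dual L"
  and dual_add: "x \<in> dual L \<Longrightarrow> y \<in> dual L \<Longrightarrow> x + y \<in> dual L"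
  and dual_neg: "x \<in> dual L \<Longrightarrow> - x \<in> dual L"
  by (auto simp: dual_def inner_add_left)

lemma subset_dual: "L \<subseteq> dual L"
  using integral by (auto simp: dual_def)

lemma mem_coset: "x \<in> coset L v \<longleftrightarrow> x - v \<in> L"
  unfolding coset_def by (metis (no_types, lifting) add_diff_cancel_left' diff_add_cancel add.commute image_iff)

lemma coset_eq_iff: "coset L v = coset L w \<longleftrightarrow> v - w \<in> L"
proof
  assume "coset L v = coset L w"
  then have "v \<in> coset L w"
    using zero_mem by (simp add: mem_coset flip: \<open>coset L v = coset L w\<close>)
  then show "v - w \<in> L"
    by (simp add: mem_coset)
next
  assume vw: "v - w \<in> L"
  have "x - v \<in> L \<longleftrightarrow> x - w \<in> L" for x
    using add_mem[OF _ vw, of "x - v"] diff_mem[OF _ vw, of "x - w"] by auto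
  then show "coset L v = coset L w"
    by (auto simp: mem_coset)
qed

lemma coset_zero: "coset L 0 = L"
  by (auto simp: mem_coset)

lemma gadd_coset: "gadd (coset L v) (coset L w) = coset L (v + w)"
proof (intro equalityI subsetI)
  fix x assume "x \<in> gadd (coset L v) (coset L w)"
  then obtain a b where "x = a + b" "a - v \<in> L" "b - w \<in> L"
    by (auto simp: gadd_def mem_coset)
  then show "x \<in> coset L (v + w)"
    using add_mem[of "a - v" "b - w"] by (simp add: mem_coset algebra_simps)
next
  fix x assume "x \<in> coset L (v + w)"
  then have "x - w \<in> coset L v" "w \<in> coset L w" "x = (x - w) + w"
    using zero_mem by (simp_all add: mem_coset algebra_simps)
  then show "x \<in> gadd (coset L v) (coset L w)"
    unfolding gadd_def by blast
qed

lemma gneg_coset: "gneg (coset L v) = coset L (- v)"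
proof -
  have "x \<in> uminus ` coset L v \<longleftrightarrow> - x \<in> coset L v" for x
    by (metis image_eqI image_iff minus_minus)
  moreover have "- x - v \<in> L \<longleftrightarrow> x + v \<in> L" for x
  proof -
    have "- x - v = - (x + v)"
      by simp
    then show ?thesis
      using neg_mem by (metis minus_minus)
  qed
  ultimately have "x \<in> gneg (coset L v) \<longleftrightarrow> x \<in> coset L (- v)" for x
    by (simp add: gneg_def mem_coset)
  then show ?thesis
    by blast
qed

lemma discE:
  assumes "X \<in> disc L"
  obtains v where "v \<in> dual L" "X = coset L v"
  using assms by (auto simp: disc_def)

lemma coset_in_disc: "v \<in> dual L \<Longrightarrow> coset L v \<in> disc L"
  by (simp add: disc_def)

lemma rep_mem:
  assumes "X \<in> disc L"
  shows "rep X \<in> X"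
proof -
  obtain v where "X = coset L v"
    using assms by (rule discE)
  then have "v \<in> X"
    using zero_mem by (simp add: mem_coset)
  then show ?thesis
    unfolding rep_def by (rule someI)
qed

lemma rep_disc:
  assumes "X \<in> disc L"
  shows "rep X \<in> dual L" "coset L (rep X) = X"
proof -
  obtain v where v: "v \<in> dual L" "X = coset L v"
    using assms by (rule discE)
  then have rv: "rep X - v \<in> L"
    using rep_mem[OF assms] by (simp add: mem_coset)
  then show "coset L (rep X) = X"
    using v(2) coset_eq_iff by simp
  have "v + (rep X - v) \<in> dual L"
    using v(1) rv subset_dual by (intro dual_add) auto
  then show "rep X \<in> dual L"
    by simp
qed

text \<open>Removes the choice made by \<open>rep\<close>: replacing dual vectors by others in their
  cosets changes the inner product by the integer
  \<open>v' \<bullet> (w' - w) + w \<bullet> (v' - v)\<close>.\<close>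

lemma pair_coset:
  assumes v: "v \<in> dual L" and w: "w \<in> dual L"
  shows "pair (coset L v) (coset L w) = cis (- 2 * pi * (v \<bullet> w))"
proof -
  define v' w' where "v' = rep (coset L v)" and "w' = rep (coset L w)"
  have v': "v' - v \<in> L" "v' \<in> dual L" and w': "w' - w \<in> L"
    using rep_mem[OF coset_in_disc[OF v]] rep_mem[OF coset_in_disc[OF w]]
      rep_disc(1)[OF coset_in_disc[OF v]]
    by (simp_all add: v'_def w'_def mem_coset)
  have "v' \<bullet> (w' - w) \<in> \<int>" "w \<bullet> (v' - v) \<in> \<int>"
    using v' w' w by (auto simp: dual_def)
  then have "v' \<bullet> (w' - w) + w \<bullet> (v' - v) \<in> \<int>"
    by (rule Ints_add)
  then have "v' \<bullet> w' - v \<bullet> w \<in> \<int>"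
    by (simp add: inner_diff_right inner_commute)
  then show ?thesis
    unfolding pair_cis v'_def w'_def by (rule cis_2pi_cong)
qed

end

text \<open>The two extra facts turn the discriminant group into a
  \<open>nondegenerate_pairing\<close>: finiteness, and the statement that a vector with integral
  product against the whole dual lattice represents the trivial class.\<close>

locale full_integral_lattice = integral_lattice L for L :: "(real^'n) set" +
  assumes finite_disc: "finite (disc L)"
    and dual_dual: "dual (dual L) \<subseteq> L"
begin

sublocale D: nondegenerate_pairing "discriminant_group L" pair
proof -
  have comm: "comm_group (discriminant_group L)"
  proof (rule comm_groupI)
    show "\<exists>y\<in>carrier (discriminant_group L).
        y \<otimes>\<^bsub>discriminant_group L\<^esub> x = \<one>\<^bsub>discriminant_group L\<^esub>"
      if x: "x \<in> carrier (discriminant_group L)" for x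
    proof -
      obtain v where v: "v \<in> dual L" "x = coset L v"
        using x by (auto elim: discE)
      then show ?thesis
        by (auto simp: gadd_coset coset_zero coset_in_disc dual_neg intro!: bexI[of _ "coset L (- v)"])
    qed
  qed (auto elim!: discE simp: gadd_coset gadd_coset[of 0, unfolded coset_zero] coset_in_disc
      dual_add ac_simps intro: coset_in_disc[OF dual_zero, unfolded coset_zero])
  then interpret comm_group "discriminant_group L" .
  show "nondegenerate_pairing (discriminant_group L) pair"
  proof
    show "finite (carrier (discriminant_group L))"
      using finite_disc by simp
    show "bicharacter (discriminant_group L) (carrier (discriminant_group L)) pair"
      by (rule bicharacterI)
        (auto elim!: discE simp: gadd_coset pair_coset dual_add circle_def cis_mult inner_add_left
          inner_add_right algebra_simps)
    show "pair x y = pair y x" for x y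
      by (simp add: pair_cis inner_commute)
    show "x = \<one>\<^bsub>discriminant_group L\<^esub>"
      if x: "x \<in> carrier (discriminant_group L)"
        and triv: "\<And>y. y \<in> carrier (discriminant_group L) \<Longrightarrow> pair x y = 1" for x
    proof -
      obtain v where v: "v \<in> dual L" "x = coset L v"
        using x by (auto elim: discE)
      have "v \<bullet> w \<in> \<int>" if "w \<in> dual L" for w
        using triv[of "coset L w"] that v cis_2pi_eq_1_iff by (simp add: coset_in_disc pair_coset)
      then have "v \<in> L"
        using dual_dual by (auto simp: dual_def)
      then show ?thesis
        using v(2) coset_eq_iff[of v 0] by (simp add: coset_zero)
    qed
  qed
qed

lemma inv_discriminant_group:
  assumes "X \<in> disc L"
  shows "inv\<^bsub>discriminant_group L\<^esub> X = gneg X"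
proof (rule D.inv_equality)
  obtain v where v: "v \<in> dual L" "X = coset L v"
    using assms by (rule discE)
  then show "gneg X \<in> carrier (discriminant_group L)" "X \<in> carrier (discriminant_group L)"
    "gneg X \<otimes>\<^bsub>discriminant_group L\<^esub> X = \<one>\<^bsub>discriminant_group L\<^esub>"
    by (auto simp: gneg_coset gadd_coset coset_zero coset_in_disc dual_neg)
qed

lemma subgrp_iff: "subgrp L J \<longleftrightarrow> subgroup J (discriminant_group L)"
proof
  show "subgroup J (discriminant_group L)" if "subgrp L J"
    using that inv_discriminant_group by unfold_locales (auto simp: subgrp_def subset_iff)
  show "subgrp L J" if J: "subgroup J (discriminant_group L)"
    using subgroup.subset[OF J] subgroup.one_closed[OF J] subgroup.m_closed[OF J]
      subgroup.m_inv_closed[OF J] inv_discriminant_group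
    by (auto simp: subgrp_def subset_iff)
qed

lemma subgrp2_iff: "subgrp2 L Z \<longleftrightarrow> D.subgroup2 Z"
proof -
  have "(\<forall>x\<in>Z. (gneg (fst x), gneg (snd x)) \<in> Z)
      \<longleftrightarrow> (\<forall>(g, h)\<in>Z. (inv\<^bsub>discriminant_group L\<^esub> g, inv\<^bsub>discriminant_group L\<^esub> h) \<in> Z)"
    if "Z \<subseteq> disc L \<times> disc L"
    using that by (force simp: inv_discriminant_group subset_iff split_beta)
  then show ?thesis
    unfolding subgrp2_def D.subgroup2_def by (auto simp: split_beta)
qed

lemma perp_eq:
  assumes "Z \<subseteq> disc L \<times> disc L"
  shows "perp L Z = D.orthogonal Z"
proof -
  have "z * cnj w = 1 \<longleftrightarrow> z = w" if "z \<in> circle" "w \<in> circle" for z w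
    using that circle_cnj circle_nonzero by (metis divide_inverse right_inverse_eq)
  then have "pair2 k z = 1 \<longleftrightarrow> pair (fst k) (fst z) = pair (snd k) (snd z)"
    if "k \<in> disc L \<times> disc L" "z \<in> disc L \<times> disc L" for k z
    using that by (simp add: pair2_def D.pairing_circle mem_Times_iff)
  then show ?thesis
    using assms unfolding perp_def D.orthogonal_def
    by (auto simp: split_beta subset_iff)
qed

lemma coset_pow:
  assumes "v \<in> dual L"
  shows "coset L v [^]\<^bsub>discriminant_group L\<^esub> (n::nat) = coset L (real n *\<^sub>R v)"
  by (induction n) (auto simp: coset_zero gadd_coset algebra_simps)

lemma gord_eq:
  assumes "X \<in> disc L"
  shows "gord L X = D.ord X"
proof -
  have X: "X \<in> carrier (discriminant_group L)"
    using assms by simp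
  have pow: "real n *\<^sub>R rep X \<in> L \<longleftrightarrow> D.ord X dvd n" for n
  proof -
    have "X [^]\<^bsub>discriminant_group L\<^esub> n = coset L (real n *\<^sub>R rep X)"
      using coset_pow[OF rep_disc(1)[OF assms], of n] rep_disc(2)[OF assms] by simp
    then show ?thesis
      using D.pow_eq_id[OF X, of n] coset_eq_iff[of "real n *\<^sub>R rep X" 0] by (simp add: coset_zero)
  qed
  show ?thesis
    unfolding gord_def pow
  proof (rule Least_equality)
    show "0 < D.ord X \<and> D.ord X dvd D.ord X"
      using D.ord_ge_1[OF D.fin X] by simp
  qed (auto dest: dvd_imp_le)
qed

lemma quaternionic_iff: "X \<in> disc L \<Longrightarrow> quaternionic L X \<longleftrightarrow> D.quaternion_element X"
  by (simp add: quaternionic_def D.quaternion_element_def gord_eq)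

end

section \<open>Cohomology classes, sign characters and the classifying triples\<close>

context full_integral_lattice
begin

abbreviation alternation :: "((real^'n) set \<Rightarrow> (real^'n) set \<Rightarrow> complex) \<Rightarrow> (real^'n) set \<Rightarrow> (real^'n) set \<Rightarrow> complex" where
  "alternation \<psi> a b \<equiv> \<psi> a b / \<psi> b a"

lemma subgroup_disc:
  assumes "subgroup J (discriminant_group L)"
  shows "x \<in> J \<Longrightarrow> x \<in> disc L" "x \<in> J \<Longrightarrow> y \<in> J \<Longrightarrow> gadd x y \<in> J"
  using subgroup.mem_carrier[OF assms] subgroup.m_closed[OF assms] by auto

lemma gadd_commute: "x \<in> disc L \<Longrightarrow> y \<in> disc L \<Longrightarrow> gadd x y = gadd y x"
  using D.m_comm by simp

lemma cocycles_eq: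
  "cocycles J = {\<psi>. cocycle_on (discriminant_group L) J \<psi> \<and> (\<forall>a b. a \<notin> J \<or> b \<notin> J \<longrightarrow> \<psi> a b = 1)}"
  by (auto simp: cocycles_def cocycle_on_def)

lemma cohom_refl: "cohom J \<psi> \<psi>"
  unfolding cohom_def by (intro exI[of _ "\<lambda>_. 1"]) simp

lemma cohom_sym:
  assumes J: "subgroup J (discriminant_group L)" and "cohom J \<psi> \<psi>'"
  shows "cohom J \<psi>' \<psi>"
proof -
  obtain f where f: "\<And>a. a \<in> J \<Longrightarrow> f a \<in> circle"
    "\<And>a b. a \<in> J \<Longrightarrow> b \<in> J \<Longrightarrow> \<psi>' a b = \<psi> a b * f a * f b / f (gadd a b)"
    using assms(2) by (auto simp: cohom_def)
  have "f a \<noteq> 0" if "a \<in> J" for a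
    using f(1) that circle_nonzero by blast
  then show ?thesis
    unfolding cohom_def using f subgroup_disc(2)[OF J]
    by (intro exI[of _ "\<lambda>a. 1 / f a"]) (auto simp: circle_divide field_simps)
qed

lemma cohom_trans:
  assumes "cohom J \<psi> \<psi>'" "cohom J \<psi>' \<psi>''"
  shows "cohom J \<psi> \<psi>''"
proof -
  obtain f g where "\<And>a. a \<in> J \<Longrightarrow> f a \<in> circle" "\<And>a. a \<in> J \<Longrightarrow> g a \<in> circle"
    "\<And>a b. a \<in> J \<Longrightarrow> b \<in> J \<Longrightarrow> \<psi>' a b = \<psi> a b * f a * f b / f (gadd a b)"
    "\<And>a b. a \<in> J \<Longrightarrow> b \<in> J \<Longrightarrow> \<psi>'' a b = \<psi>' a b * g a * g b / g (gadd a b)"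
    using assms unfolding cohom_def by metis
  then show ?thesis
    unfolding cohom_def by (intro exI[of _ "\<lambda>a. f a * g a"]) (auto simp: circle_mult)
qed

text \<open>The factor \<open>f a * f b / f (gadd a b)\<close> is symmetric because the group is
  abelian, and so it cancels in the quotient.\<close>

lemma alternation_cohom:
  assumes J: "subgroup J (discriminant_group L)" and "cohom J \<psi> \<psi>'" and ab: "a \<in> J" "b \<in> J"
  shows "alternation \<psi>' a b = alternation \<psi> a b"
proof -
  obtain f where f: "\<And>a. a \<in> J \<Longrightarrow> f a \<in> circle"
    "\<And>a b. a \<in> J \<Longrightarrow> b \<in> J \<Longrightarrow> \<psi>' a b = \<psi> a b * f a * f b / f (gadd a b)"
    using assms(2) by (auto simp: cohom_def)
  have "f a \<noteq> 0" "f b \<noteq> 0" "f (gadd a b) \<noteq> 0"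
    using f(1) ab subgroup_disc(2)[OF J] circle_nonzero by blast+
  moreover have "gadd b a = gadd a b"
    using gadd_commute subgroup_disc(1)[OF J] ab by blast
  ultimately show ?thesis
    using f(2) ab by simp
qed

text \<open>The quotient of the two cocycles is a symmetric cocycle, hence a coboundary.
  \<open>J\<close> is made a group of its own because that result concerns cocycles on a whole
  carrier.\<close>

lemma cohom_if_alternation_eq:
  assumes J: "subgroup J (discriminant_group L)"
    and \<psi>: "cocycle_on (discriminant_group L) J \<psi>" "cocycle_on (discriminant_group L) J \<psi>'"
    and eq: "\<And>a b. a \<in> J \<Longrightarrow> b \<in> J \<Longrightarrow> alternation \<psi> a b = alternation \<psi>' a b"
  shows "cohom J \<psi> \<psi>'"
proof -
  let ?GJ = "(discriminant_group L)\<lparr>carrier := J\<rparr>"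
  interpret GJ: comm_group ?GJ
  proof (rule group.group_comm_groupI)
    show "group ?GJ"
      using subgroup.subgroup_is_group[OF J] D.is_group by blast
    show "x \<otimes>\<^bsub>?GJ\<^esub> y = y \<otimes>\<^bsub>?GJ\<^esub> x" if "x \<in> carrier ?GJ" "y \<in> carrier ?GJ" for x y
      using that gadd_commute subgroup_disc(1)[OF J] by simp
  qed
  have 0: "\<psi> a b \<noteq> 0" "\<psi>' a b \<noteq> 0" if "a \<in> J" "b \<in> J" for a b
    using \<psi> that circle_nonzero unfolding cocycle_on_def by blast+
  define \<chi>' where "\<chi>' a b = \<psi>' a b / \<psi> a b" for a b
  have "cocycle_on ?GJ (carrier ?GJ) \<chi>'"
    unfolding cocycle_on_def
  proof (intro conjI ballI)
    fix a b assume ab: "a \<in> carrier ?GJ" "b \<in> carrier ?GJ"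
    then show "\<chi>' a b \<in> circle"
      using \<psi> by (auto simp: \<chi>'_def cocycle_on_def circle_divide)
    fix c assume c: "c \<in> carrier ?GJ"
    have "\<psi> b c * \<psi> a (gadd b c) = \<psi> (gadd a b) c * \<psi> a b"
      "\<psi>' b c * \<psi>' a (gadd b c) = \<psi>' (gadd a b) c * \<psi>' a b"
      using \<psi> ab c by (auto simp: cocycle_on_def)
    then show "\<chi>' b c * \<chi>' a (b \<otimes>\<^bsub>?GJ\<^esub> c) = \<chi>' (a \<otimes>\<^bsub>?GJ\<^esub> b) c * \<chi>' a b"
      by (simp add: \<chi>'_def times_divide_times_eq)
  qed
  moreover have "finite (carrier ?GJ)"
    using finite_disc subgroup.subset[OF J] finite_subset by auto
  moreover have "\<chi>' a b = \<chi>' b a" if "a \<in> carrier ?GJ" "b \<in> carrier ?GJ" for a b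
    using eq[of a b] 0[of a b] 0[of b a] that by (simp add: \<chi>'_def field_simps)
  ultimately obtain f where f: "\<And>a. a \<in> J \<Longrightarrow> f a \<in> circle"
    "\<And>a b. a \<in> J \<Longrightarrow> b \<in> J \<Longrightarrow> \<chi>' a b = f a * f b / f (gadd a b)"
    using GJ.symmetric_cocycle_coboundary[of \<chi>'] by auto
  have "\<psi>' a b = \<psi> a b * f a * f b / f (gadd a b)" if "a \<in> J" "b \<in> J" for a b
  proof -
    have "\<psi>' a b = \<psi> a b * \<chi>' a b"
      using 0 that by (simp add: \<chi>'_def)
    then show ?thesis
      using f(2) that by simp
  qed
  then show ?thesis
    unfolding cohom_def using f(1) by blast
qed

lemma H2_class:
  assumes J: "subgroup J (discriminant_group L)" and c: "c \<in> H2 J" and \<psi>: "\<psi> \<in> c"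
  shows "\<psi> \<in> cocycles J" "c = {\<psi>' \<in> cocycles J. cohom J \<psi> \<psi>'}"
proof -
  obtain \<psi>0 where \<psi>0: "c = {\<psi>' \<in> cocycles J. cohom J \<psi>0 \<psi>'}"
    using c by (auto simp: H2_def)
  then show "\<psi> \<in> cocycles J"
    using \<psi> by blast
  have "cohom J \<psi>0 \<psi>' \<longleftrightarrow> cohom J \<psi> \<psi>'" for \<psi>'
    using \<psi> \<psi>0 cohom_trans cohom_sym[OF J] by blast
  then show "c = {\<psi>' \<in> cocycles J. cohom J \<psi> \<psi>'}"
    using \<psi>0 by simp
qed

text \<open>Any element of the class would serve for building forms: only its
  \<open>alternation\<close> enters there, and that is constant on the class.\<close>

definition class_rep :: "((real^'n) set \<Rightarrow> (real^'n) set \<Rightarrow> complex) set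
    \<Rightarrow> (real^'n) set \<Rightarrow> (real^'n) set \<Rightarrow> complex" where
  "class_rep c = (SOME \<psi>. \<psi> \<in> c)"

lemma class_rep:
  assumes "c \<in> H2 J"
  shows "class_rep c \<in> c"
proof -
  have "\<exists>\<psi>. \<psi> \<in> c"
    using assms cohom_refl by (auto simp: H2_def)
  then show ?thesis
    unfolding class_rep_def by (rule someI_ex)
qed

text \<open>On \<open>J\<close> write \<phi> as \<open>(-1) ^ a\<close> with \<open>a\<close>
  additive modulo 2. Then this is \<open>(-1) ^ (a x * a y)\<close>, a symmetric bicharacter with
  values 1 and -1, whose diagonal is \<phi> because squaring is the identity modulo 2.\<close>

definition sign_form :: "((real^'n) set \<Rightarrow> complex) \<Rightarrow> (real^'n) set \<Rightarrow> (real^'n) set \<Rightarrow> complex" where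
  "sign_form \<phi> x y = (if \<phi> x = 1 then 1 else \<phi> y)"

lemma chars2_cases:
  assumes "\<phi> \<in> chars2 J" "x \<in> J"
  shows "\<phi> x = 1 \<or> \<phi> x = -1"
proof -
  have "\<phi> x * \<phi> x = 1"
    using assms by (auto simp: chars2_def)
  then show ?thesis
    using square_eq_1_iff by blast
qed

lemma sign_form:
  assumes \<phi>: "\<phi> \<in> chars2 J"
  shows "bicharacter (discriminant_group L) J (sign_form \<phi>)"
    and "\<And>x y. x \<in> J \<Longrightarrow> y \<in> J \<Longrightarrow> sign_form \<phi> x y * sign_form \<phi> y x = 1"
    and "\<And>x. sign_form \<phi> x x = \<phi> x"
proof -
  have mult: "\<phi> (gadd x y) = \<phi> x * \<phi> y" if "x \<in> J" "y \<in> J" for x y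
    using \<phi> that by (auto simp: chars2_def)
  show "bicharacter (discriminant_group L) J (sign_form \<phi>)"
  proof (rule bicharacterI)
    show "sign_form \<phi> x y \<in> circle" if "x \<in> J" "y \<in> J" for x y
      using chars2_cases[OF \<phi> that(2)] by (auto simp: sign_form_def circle_def)
  next
    fix x y z assume xyz: "x \<in> J" "y \<in> J" "z \<in> J"
    show "sign_form \<phi> (x \<otimes>\<^bsub>discriminant_group L\<^esub> y) z = sign_form \<phi> x z * sign_form \<phi> y z"
      "sign_form \<phi> x (y \<otimes>\<^bsub>discriminant_group L\<^esub> z) = sign_form \<phi> x y * sign_form \<phi> x z"
      using chars2_cases[OF \<phi> xyz(1)] chars2_cases[OF \<phi> xyz(2)] chars2_cases[OF \<phi> xyz(3)] xyz
      by (auto simp: sign_form_def mult)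
  qed
  show "sign_form \<phi> x y * sign_form \<phi> y x = 1" if "x \<in> J" "y \<in> J" for x y
    using chars2_cases[OF \<phi> that(1)] chars2_cases[OF \<phi> that(2)] by (auto simp: sign_form_def)
  show "sign_form \<phi> x x = \<phi> x" for x
    by (simp add: sign_form_def)
qed

text \<open>The origin chosen among the polarizations on \<open>J\<close>; the others are measured
  relative to it.\<close>

definition base_polarization :: "(real^'n) set set \<Rightarrow> (real^'n) set \<Rightarrow> (real^'n) set \<Rightarrow> complex" where
  "base_polarization J = (SOME \<beta>. D.polarization J \<beta>)"

definition form_of_triple where
  "form_of_triple J c \<phi> x y
     = base_polarization J x y * sign_form \<phi> x y * alternation (class_rep c) x y"

definition triples where
  "triples = {(J, c, \<phi>). subgrp L J \<and> (\<forall>j\<in>J. \<not> quaternionic L j) \<and> c \<in> H2 J \<and> \<phi> \<in> chars2 J}"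

context
  fixes J
  assumes J: "subgroup J (discriminant_group L)" and nq: "\<forall>j\<in>J. \<not> quaternionic L j"
begin

lemma base_polarization: "D.polarization J (base_polarization J)"
proof -
  have "\<exists>\<beta>. D.polarization J \<beta>"
    using nq subgroup_disc(1)[OF J] by (intro D.polarization_exists[OF J]) (auto simp: quaternionic_iff)
  then show ?thesis
    unfolding base_polarization_def by (rule someI_ex)
qed

lemmas base_bichar = D.polarizationD(1)[OF base_polarization]
lemmas base_pol = D.polarizationD(2)[OF base_polarization]
lemmas base_nonzero = bicharacter_nonzero[OF base_bichar]

lemma class_rep_cocycle:
  assumes "c \<in> H2 J"
  shows "cocycle_on (discriminant_group L) J (class_rep c)"
  using H2_class(1)[OF J assms class_rep[OF assms]] by (simp add: cocycles_eq)

lemma class_rep_nonzero: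
  assumes "c \<in> H2 J" "x \<in> J" "y \<in> J"
  shows "class_rep c x y \<noteq> 0"
  using class_rep_cocycle[OF assms(1)] assms(2,3) circle_nonzero unfolding cocycle_on_def by blast

text \<open>The alternating factor is 1 on the diagonal, so \<phi> can be read off before the
  cohomology class is known.\<close>

lemma form_of_triple_diag:
  assumes "c \<in> H2 J" "\<phi> \<in> chars2 J" "x \<in> J"
  shows "form_of_triple J c \<phi> x x = base_polarization J x x * \<phi> x"
  using class_rep_nonzero[OF assms(1,3,3)] by (simp add: form_of_triple_def sign_form(3)[OF assms(2)])

lemma form_of_triple_polarization:
  assumes c: "c \<in> H2 J" and \<phi>: "\<phi> \<in> chars2 J"
  shows "D.polarization J (form_of_triple J c \<phi>)"
  unfolding D.polarization_def
proof (intro conjI ballI)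
  have "bicharacter (discriminant_group L) J (\<lambda>x y. base_polarization J x y * sign_form \<phi> x y
      * alternation (class_rep c) x y)"
    by (intro bicharacter_times base_bichar sign_form(1)[OF \<phi>]
        D.cocycle_alternation[OF J class_rep_cocycle[OF c]])
  then show "bicharacter (discriminant_group L) J (form_of_triple J c \<phi>)"
    by (simp add: form_of_triple_def[abs_def])
  fix x y assume xy: "x \<in> J" "y \<in> J"
  have "alternation (class_rep c) x y * alternation (class_rep c) y x = 1"
    using class_rep_nonzero[OF c] xy by simp
  moreover have "form_of_triple J c \<phi> x y * form_of_triple J c \<phi> y x
      = (base_polarization J x y * base_polarization J y x) * (sign_form \<phi> x y * sign_form \<phi> y x)
        * (alternation (class_rep c) x y * alternation (class_rep c) y x)"
    unfolding form_of_triple_def by (simp only: mult_ac)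
  ultimately show "form_of_triple J c \<phi> x y * form_of_triple J c \<phi> y x = pair x y"
    using base_pol[OF xy] sign_form(2)[OF \<phi> xy] by simp
qed

lemma form_of_triple_inject:
  assumes c: "c \<in> H2 J" "c' \<in> H2 J" and \<phi>: "\<phi> \<in> chars2 J" "\<phi>' \<in> chars2 J"
    and eq: "\<And>x y. x \<in> J \<Longrightarrow> y \<in> J \<Longrightarrow> form_of_triple J c \<phi> x y = form_of_triple J c' \<phi>' x y"
  shows "c = c'" "\<phi> = \<phi>'"
proof -
  have "\<phi> x = \<phi>' x" if "x \<in> J" for x
    using eq[OF that that] base_nonzero[OF that that]
    by (simp add: form_of_triple_diag[OF c(1) \<phi>(1) that] form_of_triple_diag[OF c(2) \<phi>(2) that])
  \<comment> \<open>Elements of \<open>chars2 J\<close> are normalised to 1 outside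
    \<open>J\<close>, so agreement on \<open>J\<close> gives equality of functions.\<close>
  moreover have "\<phi> x = \<phi>' x" if "x \<notin> J" for x
    using \<phi> that by (simp add: chars2_def)
  ultimately show "\<phi> = \<phi>'"
    by blast
  have "alternation (class_rep c) x y = alternation (class_rep c') x y" if xy: "x \<in> J" "y \<in> J" for x y
    using eq[OF xy] base_nonzero[OF xy] bicharacter_nonzero[OF sign_form(1)[OF \<phi>(2)] xy]
    unfolding form_of_triple_def \<open>\<phi> = \<phi>'\<close> by (simp only: mult_cancel_left mult_eq_0_iff simp_thms)
  then have "cohom J (class_rep c) (class_rep c')"
    using cohom_if_alternation_eq[OF J class_rep_cocycle[OF c(1)] class_rep_cocycle[OF c(2)]] by blast
  then have "class_rep c' \<in> c"
    using H2_class[OF J c(1) class_rep[OF c(1)]] H2_class(1)[OF J c(2) class_rep[OF c(2)]] by blast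
  then show "c = c'"
    using H2_class(2)[OF J c(1)] H2_class(2)[OF J c(2) class_rep[OF c(2)]] by simp
qed

lemma form_of_triple_surj:
  assumes \<beta>: "D.polarization J \<beta>"
  obtains c \<phi> where "c \<in> H2 J" "\<phi> \<in> chars2 J"
    "\<And>x y. x \<in> J \<Longrightarrow> y \<in> J \<Longrightarrow> form_of_triple J c \<phi> x y = \<beta> x y"
proof -
  define \<gamma> where "\<gamma> x y = \<beta> x y / base_polarization J x y" for x y
  have \<gamma>: "bicharacter (discriminant_group L) J \<gamma>"
    unfolding \<gamma>_def[abs_def]
    by (rule bicharacter_divide[OF D.polarizationD(1)[OF \<beta>] base_bichar])
  have \<gamma>_anti: "\<gamma> x y * \<gamma> y x = 1" if xy: "x \<in> J" "y \<in> J" for x y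
    using D.polarizationD(2)[OF \<beta> xy] base_pol[OF xy] D.pairing_nonzero subgroup_disc(1)[OF J] xy
    by (simp add: \<gamma>_def)
  \<comment> \<open>The diagonal of a bicharacter is quadratic in general. Here the cross terms
    \<open>\<gamma> x y * \<gamma> y x\<close> are 1, which makes it multiplicative, and
    \<open>\<gamma> x x\<close> squares to 1, which makes it trivial on doubles.\<close>
  define \<phi> where "\<phi> x = (if x \<in> J then \<gamma> x x else 1)" for x
  have \<phi>: "\<phi> \<in> chars2 J"
    unfolding chars2_def
  proof (intro CollectI conjI ballI allI impI)
    fix x y assume xy: "x \<in> J" "y \<in> J"
    show "\<phi> x \<in> circle"
      using xy bicharacter_circle[OF \<gamma>] by (simp add: \<phi>_def)
    have "\<gamma> (gadd x y) (gadd x y) = \<gamma> x x * \<gamma> y y * (\<gamma> x y * \<gamma> y x)"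
      using xy subgroup_disc(2)[OF J] bicharacter_mult_left[OF \<gamma>] bicharacter_mult_right[OF \<gamma>]
      by simp
    then show "\<phi> (gadd x y) = \<phi> x * \<phi> y"
      using xy subgroup_disc(2)[OF J] \<gamma>_anti by (simp add: \<phi>_def)
  next
    fix x assume x: "x \<in> J"
    have "\<gamma> (gadd x x) (gadd x x) = (\<gamma> x x * \<gamma> x x) * (\<gamma> x x * \<gamma> x x)"
      using x subgroup_disc(2)[OF J] bicharacter_mult_left[OF \<gamma>] bicharacter_mult_right[OF \<gamma>]
      by simp
    then show "\<phi> (gadd x x) = 1"
      using x subgroup_disc(2)[OF J] \<gamma>_anti by (simp add: \<phi>_def)
  qed (simp add: \<phi>_def)
  note sf = sign_form[OF \<phi>]
  define \<alpha> where "\<alpha> x y = \<gamma> x y / sign_form \<phi> x y" for x y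
  have \<alpha>: "bicharacter (discriminant_group L) J \<alpha>"
    unfolding \<alpha>_def[abs_def] by (rule bicharacter_divide[OF \<gamma> sf(1)])
  have \<alpha>_anti: "\<alpha> x y * \<alpha> y x = 1" if xy: "x \<in> J" "y \<in> J" for x y
    using \<gamma>_anti[OF xy] sf(2)[OF xy] by (simp add: \<alpha>_def times_divide_times_eq)
  have \<alpha>_alt: "\<alpha> x x = 1" if "x \<in> J" for x
    using that bicharacter_nonzero[OF \<gamma>] by (simp add: \<alpha>_def sf(3)) (simp add: \<phi>_def)
  \<comment> \<open>With \<open>s = -1\<close> the product \<open>\<zeta> * \<zeta> powi s\<close>
    is always 1, so the diagonal condition of the factorization is that \<alpha> is alternating.
    This is why the sign form has been divided out beforehand.\<close>
  have "\<exists>\<delta>. bicharacter (discriminant_group L) J \<delta>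
      \<and> (\<forall>x\<in>J. \<forall>y\<in>J. \<delta> x y * \<delta> y x powi (-1) = \<alpha> x y)"
  proof (rule D.bicharacter_factorization[OF D.fin J _ \<alpha>])
    show "\<alpha> y x = \<alpha> x y powi (-1)" if "x \<in> J" "y \<in> J" for x y
      using inverse_unique[OF \<alpha>_anti[OF that]] by (simp add: power_int_minus)
    show "\<exists>\<zeta>\<in>circle. \<zeta> ^ D.ord x = 1 \<and> \<zeta> * \<zeta> powi (-1) = \<alpha> x x" if "x \<in> J" for x
      using \<alpha>_alt[OF that] by (intro bexI[of _ 1]) auto
  qed simp
  then obtain \<delta> where \<delta>: "bicharacter (discriminant_group L) J \<delta>"
    and \<delta>_eq: "\<And>x y. x \<in> J \<Longrightarrow> y \<in> J \<Longrightarrow> \<delta> x y * \<delta> y x powi (-1) = \<alpha> x y"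
    by blast
  \<comment> \<open>Extended by 1 outside \<open>J\<close>, as membership in
    \<open>cocycles J\<close> demands.\<close>
  define \<psi> where "\<psi> x y = (if x \<in> J \<and> y \<in> J then \<delta> x y else 1)" for x y
  have "cocycle_on (discriminant_group L) J \<psi>"
    using D.bicharacter_cocycle[OF J \<delta>] subgroup_disc(2)[OF J] by (auto simp: cocycle_on_def \<psi>_def)
  then have \<psi>: "\<psi> \<in> cocycles J"
    by (auto simp: cocycles_eq \<psi>_def)
  define c where "c = {\<psi>' \<in> cocycles J. cohom J \<psi> \<psi>'}"
  have c: "c \<in> H2 J"
    using \<psi> by (auto simp: H2_def c_def)
  have "cohom J \<psi> (class_rep c)"
    using class_rep[OF c] by (simp add: c_def)
  then have alt: "alternation (class_rep c) x y = \<alpha> x y" if "x \<in> J" "y \<in> J" for x y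
    using alternation_cohom[OF J _ that] \<delta>_eq[OF that] that
    by (simp add: \<psi>_def power_int_minus divide_inverse)
  have "form_of_triple J c \<phi> x y = \<beta> x y" if xy: "x \<in> J" "y \<in> J" for x y
    using base_nonzero[OF xy] bicharacter_nonzero[OF sf(1) xy]
    by (simp add: form_of_triple_def alt[OF xy] \<alpha>_def \<gamma>_def)
  then show thesis
    using that c \<phi> by blast
qed

end

text \<open>The map runs from triples to subgroups because this direction has an explicit formula;
  recovering a triple from \<open>Z\<close> involves choices that cancel only in the result.\<close>

lemma bij_betw_triples:
  "bij_betw (\<lambda>(J, c, \<phi>). D.lagrangian J (form_of_triple J c \<phi>)) triples
    {Z. subgrp2 L Z \<and> perp L Z = Z}"
proof -
  have self_perp: "subgrp2 L Z \<and> perp L Z = Z \<longleftrightarrow> D.subgroup2 Z \<and> D.orthogonal Z = Z" for Z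
  proof -
    have "perp L Z = D.orthogonal Z" if "D.subgroup2 Z"
      using that by (intro perp_eq) (simp add: D.subgroup2_def)
    then show ?thesis
      using subgrp2_iff by metis
  qed
  show ?thesis
    unfolding bij_betw_def
  proof (intro conjI inj_onI equalityI subsetI)
    fix t t'
    assume t: "t \<in> triples" "t' \<in> triples"
      and eq: "(case t of (J, c, \<phi>) \<Rightarrow> D.lagrangian J (form_of_triple J c \<phi>))
        = (case t' of (J, c, \<phi>) \<Rightarrow> D.lagrangian J (form_of_triple J c \<phi>))"
    obtain J c \<phi> J' c' \<phi>' where tt: "t = (J, c, \<phi>)" "t' = (J', c', \<phi>')"
      by (metis prod_cases3)
    have J: "subgroup J (discriminant_group L)" "\<forall>j\<in>J. \<not> quaternionic L j" "c \<in> H2 J" "\<phi> \<in> chars2 J"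
      and J': "subgroup J' (discriminant_group L)" "\<forall>j\<in>J'. \<not> quaternionic L j" "c' \<in> H2 J'"
        "\<phi>' \<in> chars2 J'"
      using t by (auto simp: tt triples_def subgrp_iff)
    note pol = D.polarizationD(1)[OF form_of_triple_polarization[OF J]]
    note pol' = D.polarizationD(1)[OF form_of_triple_polarization[OF J']]
    have "D.lagrangian J (form_of_triple J c \<phi>) = D.lagrangian J' (form_of_triple J' c' \<phi>')"
      using eq by (simp add: tt)
    note inj = D.lagrangian_inject[OF J(1) pol J'(1) pol' this]
    have "c = c'" "\<phi> = \<phi>'"
      using form_of_triple_inject[OF J(1,2,3) _ J(4)] J'(3,4) inj by metis+
    then show "t = t'"
      using inj(1) by (simp add: tt)
  next
    fix Z assume "Z \<in> (\<lambda>(J, c, \<phi>). D.lagrangian J (form_of_triple J c \<phi>)) ` triples"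
    then obtain J c \<phi> where Z: "Z = D.lagrangian J (form_of_triple J c \<phi>)"
      and J: "subgroup J (discriminant_group L)" "\<forall>j\<in>J. \<not> quaternionic L j" "c \<in> H2 J" "\<phi> \<in> chars2 J"
      by (auto simp: triples_def subgrp_iff)
    note pol = form_of_triple_polarization[OF J]
    show "Z \<in> {Z. subgrp2 L Z \<and> perp L Z = Z}"
      using D.lagrangian_subgroup[OF J(1) D.polarizationD(1)[OF pol]] D.orthogonal_lagrangian[OF J(1) pol]
      by (simp add: Z self_perp)
  next
    fix Z assume "Z \<in> {Z. subgrp2 L Z \<and> perp L Z = Z}"
    then obtain J \<beta> where J: "subgroup J (discriminant_group L)" and \<beta>: "D.polarization J \<beta>"
      and Z: "Z = D.lagrangian J \<beta>"
      using D.lagrangian_exists[of Z] by (auto simp: self_perp)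
    \<comment> \<open>Membership in \<open>triples\<close> requires this, and so do the facts about
      \<open>form_of_triple\<close>, whose origin \<open>base_polarization J\<close> was obtained
      from it.\<close>
    have nq: "\<forall>j\<in>J. \<not> quaternionic L j"
      using D.polarization_no_quaternion[OF J \<beta>] subgroup_disc(1)[OF J] by (simp add: quaternionic_iff)
    obtain c \<phi> where c: "c \<in> H2 J" "\<phi> \<in> chars2 J"
      and eq: "\<And>x y. x \<in> J \<Longrightarrow> y \<in> J \<Longrightarrow> form_of_triple J c \<phi> x y = \<beta> x y"
      using form_of_triple_surj[OF J nq \<beta>] by blast
    have "Z = D.lagrangian J (form_of_triple J c \<phi>)"
      unfolding Z D.lagrangian_def using eq by auto
    moreover have "(J, c, \<phi>) \<in> triples"
      using J nq c by (simp add: triples_def subgrp_iff)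
    ultimately show "Z \<in> (\<lambda>(J, c, \<phi>). D.lagrangian J (form_of_triple J c \<phi>)) ` triples"
      by force
  qed
qed

end

section \<open>Lattices spanned by a basis\<close>

lemma lat_combination_mem: "(\<Sum>i\<in>UNIV. of_int (k i) *\<^sub>R b i) \<in> lat b"
  by (auto simp: lat_def)

lemma lat_basis_mem: "b i \<in> lat b"
proof -
  have "b i = (\<Sum>j\<in>UNIV. of_int (if j = i then 1 else 0) *\<^sub>R b j)"
    by (simp add: if_distrib[of "\<lambda>x. x *\<^sub>R _"] if_distrib[of of_int] cong: if_cong)
  then show ?thesis
    using lat_combination_mem[of "\<lambda>j. if j = i then 1 else 0" b] by (simp only:)
qed

lemma lat_zero: "0 \<in> lat b"
  using lat_combination_mem[of "\<lambda>_. 0" b] by simp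

lemma lat_add:
  assumes "u \<in> lat b" "v \<in> lat b"
  shows "u + v \<in> lat b"
proof -
  obtain k l where "u = (\<Sum>i\<in>UNIV. of_int (k i) *\<^sub>R b i)" "v = (\<Sum>i\<in>UNIV. of_int (l i) *\<^sub>R b i)"
    using assms by (auto simp: lat_def)
  then have "u + v = (\<Sum>i\<in>UNIV. of_int (k i + l i) *\<^sub>R b i)"
    by (simp add: sum.distrib scaleR_add_left)
  then show ?thesis
    by (simp only: lat_combination_mem)
qed

lemma lat_neg:
  assumes "u \<in> lat b"
  shows "- u \<in> lat b"
proof -
  obtain k where "u = (\<Sum>i\<in>UNIV. of_int (k i) *\<^sub>R b i)"
    using assms by (auto simp: lat_def)
  then have "- u = (\<Sum>i\<in>UNIV. of_int (- k i) *\<^sub>R b i)"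
    by (simp add: sum_negf)
  then show ?thesis
    by (simp only: lat_combination_mem)
qed

text \<open>Twice \<open>u \<bullet> v\<close> is the norm of \<open>u + v\<close> minus the norms
  of \<open>u\<close> and \<open>v\<close>, and all three are even integers.\<close>

lemma even_lattice_integral:
  assumes even: "\<forall>u\<in>lat b. \<exists>k::int. u \<bullet> u = 2 * of_int k" and uv: "u \<in> lat b" "v \<in> lat b"
  shows "u \<bullet> v \<in> \<int>"
proof -
  obtain k l m :: int where "u \<bullet> u = 2 * of_int k" "v \<bullet> v = 2 * of_int l"
    "(u + v) \<bullet> (u + v) = 2 * of_int m"
    using even uv lat_add by metis
  then have "u \<bullet> v = of_int (m - k - l)"
    by (simp add: inner_add_left inner_add_right inner_commute)
  then show ?thesis
    by simp
qed

text \<open>Independence of the set \<open>range b\<close> does not by itself exclude repetitions in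
  the family; counting the elements of a spanning independent set does.\<close>

lemma inj_basis:
  fixes b :: "'n::finite \<Rightarrow> real^'n"
  assumes "independent (range b)" "span (range b) = UNIV"
  shows "inj b"
proof -
  have "card (range b) = dim (UNIV :: (real^'n) set)"
    using basis_card_eq_dim[of "range b" UNIV] assms by simp
  then have "card (range b) = card (UNIV :: 'n set)"
    by simp
  then show ?thesis
    by (intro eq_card_imp_inj_on) simp_all
qed

lemma basis_coordinates:
  fixes b :: "'n::finite \<Rightarrow> real^'n"
  assumes "independent (range b)" "span (range b) = UNIV"
  obtains c where "v = (\<Sum>i\<in>UNIV. c i *\<^sub>R b i)"
proof -
  have fin: "finite (range b)" and "v \<in> span (range b)"
    using assms by auto
  then obtain d where "v = (\<Sum>w\<in>range b. d w *\<^sub>R w)"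
    unfolding span_finite[OF fin] by auto
  also have "\<dots> = (\<Sum>i\<in>UNIV. d (b i) *\<^sub>R b i)"
    using inj_basis[OF assms] by (simp add: sum.reindex)
  finally show thesis
    by (rule that)
qed

text \<open>The \<open>i\<close>-th coordinate is a linear functional, hence the inner product with
  a fixed vector, obtained by applying its adjoint to 1. This vector is the \<open>i\<close>-th
  member of the dual basis.\<close>

lemma dual_basis_vector:
  fixes b :: "'n::finite \<Rightarrow> real^'n"
  assumes "independent (range b)" "span (range b) = UNIV"
  obtains w where "\<And>c. (\<Sum>j\<in>UNIV. c j *\<^sub>R b j) \<bullet> w = c i"
proof -
  obtain g :: "real^'n \<Rightarrow> real" where g: "linear g" "\<forall>x\<in>range b. g x = (if x = b i then 1 else 0)"
    using linear_independent_extend[OF assms(1), of "\<lambda>x. if x = b i then 1 else 0"] by auto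
  have g_b: "g (b j) = (if j = i then 1 else 0)" for j
    using g(2) inj_basis[OF assms] by (auto simp: inj_eq)
  have "(\<Sum>j\<in>UNIV. c j *\<^sub>R b j) \<bullet> adjoint g 1 = c i" for c
    by (simp add: adjoint_works[OF g(1)] linear_sum[OF g(1)] linear_cmul[OF g(1)] g_b
        if_distrib[of "\<lambda>x. _ * x"] cong: if_cong)
  then show thesis
    by (rule that)
qed

text \<open>The dual basis vectors belong to the dual lattice, and pairing \<open>v\<close> with
  them yields its coordinates, which are therefore integers.\<close>

lemma lat_dual_dual:
  fixes b :: "'n::finite \<Rightarrow> real^'n"
  assumes "independent (range b)" "span (range b) = UNIV"
  shows "dual (dual (lat b)) \<subseteq> lat b"
proof
  fix v assume v: "v \<in> dual (dual (lat b))"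
  obtain c where c: "v = (\<Sum>i\<in>UNIV. c i *\<^sub>R b i)"
    using basis_coordinates[OF assms] by blast
  have "c i \<in> \<int>" for i
  proof -
    obtain w where w: "\<And>c. (\<Sum>j\<in>UNIV. c j *\<^sub>R b j) \<bullet> w = c i"
      using dual_basis_vector[OF assms] by metis
    have "w \<in> dual (lat b)"
      using w by (auto simp: dual_def lat_def inner_commute[of w])
    then have "v \<bullet> w \<in> \<int>"
      using v by (simp add: dual_def)
    then show ?thesis
      by (simp add: c w)
  qed
  then have "\<exists>k::int. c i = of_int k" for i
    by (meson Ints_cases)
  then obtain k :: "'n \<Rightarrow> int" where "\<And>i. c i = of_int (k i)"
    by metis
  then show "v \<in> lat b"
    unfolding c by (simp add: lat_combination_mem)
qed

text \<open>A dual vector is determined by its integral inner products with the basis, and these are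
  bounded once the vector is reduced into the fundamental parallelepiped.\<close>
lemma lat_finite_disc:
  fixes b :: "'n::finite \<Rightarrow> real^'n"
  assumes basis: "independent (range b)" "span (range b) = UNIV" and "integral_lattice (lat b)"
  shows "finite (disc (lat b))"
proof -
  interpret integral_lattice "lat b"
    by fact
  \<comment> \<open>Bounds the product with \<open>b i\<close> of any vector whose coordinates have
    absolute value at most 1, in particular when they are the fractional parts used below.\<close>
  define M where "M i = (\<Sum>j\<in>UNIV. \<bar>b j \<bullet> b i\<bar>)" for i
  define P where "P = {v \<in> dual (lat b). \<forall>i. \<bar>v \<bullet> b i\<bar> \<le> M i}"
  have "finite P"
  proof (rule inj_on_finite)
    show "inj_on (\<lambda>v i. v \<bullet> b i) P"
    proof (rule inj_onI)
      fix v w assume "(\<lambda>i. v \<bullet> b i) = (\<lambda>i. w \<bullet> b i)"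
      then have "(v - w) \<bullet> b i = 0" for i
        by (simp add: inner_diff_left fun_eq_iff)
      moreover obtain c where "v - w = (\<Sum>i\<in>UNIV. c i *\<^sub>R b i)"
        using basis_coordinates[OF basis] by blast
      ultimately have "(v - w) \<bullet> (v - w) = 0"
        by (metis (no_types, lifting) inner_scaleR_right inner_sum_right mult_zero_right sum.neutral)
      then show "v = w"
        by simp
    qed
    show "(\<lambda>v i. v \<bullet> b i) ` P \<subseteq> PiE UNIV (\<lambda>i. {x \<in> \<int>. \<bar>x\<bar> \<le> M i})"
      using lat_basis_mem by (auto simp: P_def dual_def)
    show "finite (PiE UNIV (\<lambda>i. {x \<in> \<int>. \<bar>x\<bar> \<le> M i}))"
      by (intro finite_PiE finite_abs_int_segment) simp
  qed
  moreover have "disc (lat b) \<subseteq> coset (lat b) ` P"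
  proof
    fix X assume "X \<in> disc (lat b)"
    then obtain v where v: "v \<in> dual (lat b)" "X = coset (lat b) v"
      by (auto simp: disc_def)
    obtain c where c: "v = (\<Sum>i\<in>UNIV. c i *\<^sub>R b i)"
      using basis_coordinates[OF basis] by blast
    define u where "u = (\<Sum>i\<in>UNIV. of_int \<lfloor>c i\<rfloor> *\<^sub>R b i)"
    have u: "u \<in> lat b"
      unfolding u_def by (rule lat_combination_mem)
    have vu: "v - u = (\<Sum>j\<in>UNIV. frac (c j) *\<^sub>R b j)"
      by (simp add: c u_def frac_def scaleR_diff_left sum_subtractf)
    have "\<bar>(v - u) \<bullet> b i\<bar> \<le> M i" for i
    proof -
      have "\<bar>(v - u) \<bullet> b i\<bar> \<le> (\<Sum>j\<in>UNIV. \<bar>frac (c j) * (b j \<bullet> b i)\<bar>)"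
        unfolding vu inner_sum_left inner_scaleR_left by (rule sum_abs)
      also have "\<dots> \<le> M i"
        unfolding M_def
      proof (rule sum_mono)
        fix j
        have "\<bar>frac (c j)\<bar> \<le> 1"
          using frac_lt_1[of "c j"] frac_ge_0[of "c j"] by simp
        then show "\<bar>frac (c j) * (b j \<bullet> b i)\<bar> \<le> \<bar>b j \<bullet> b i\<bar>"
          unfolding abs_mult by (intro mult_left_le_one_le) auto
      qed
      finally show ?thesis .
    qed
    moreover have "v - u \<in> dual (lat b)"
      using dual_add[OF v(1) dual_neg[of u]] u subset_dual by auto
    ultimately have "v - u \<in> P"
      by (simp add: P_def)
    moreover have "X = coset (lat b) (v - u)"
      using u by (simp add: v(2) coset_eq_iff)
    ultimately show "X \<in> coset (lat b) ` P"
      by blast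
  qed
  ultimately show ?thesis
    using finite_surj by blast
qed

theorem theorem3:
  fixes b :: "'n::finite \<Rightarrow> real^'n"
  assumes "independent (range b)" and "span (range b) = UNIV"
    and "\<forall>u\<in>lat b. \<exists>k::int. u \<bullet> u = 2 * of_int k"
  shows "\<exists>f. bij_betw f {Z. subgrp2 (lat b) Z \<and> perp (lat b) Z = Z}
     {(J, c, \<phi>). subgrp (lat b) J \<and> (\<forall>j\<in>J. \<not> quaternionic (lat b) j)
        \<and> c \<in> H2 J \<and> \<phi> \<in> chars2 J}"
proof -
  have "integral_lattice (lat b)"
    using lat_zero lat_add lat_neg even_lattice_integral[OF assms(3)] by unfold_locales
  then interpret full_integral_lattice "lat b"
    using lat_finite_disc[OF assms(1,2)] lat_dual_dual[OF assms(1,2)]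
    by (simp add: full_integral_lattice_def full_integral_lattice_axioms_def)
  show ?thesis
    using bij_betw_inv_into[OF bij_betw_triples] unfolding triples_def by blast
qed

end
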